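(* Let $\alpha,\beta>-1$ and $0<k<\alpha+1$, and let $W$ be the weight matrix $$W(x)=(1-x)^\alpha(1+x)^\beta\begin{pmatrix}4(\alpha+1)-2k(1-x)&2(\alpha+1-k)(1-x)\\2(\alpha+1-k)(1-x)&(\alpha+1-k)(1-x)^2\end{pmatrix},\qquad x\in(-1,1).$$ Then $\mathcal D(W)$ is a commutative full algebra.
   Context: Differential operators $D=\sum_{j}\partial^jF_j(x)$, $\partial=\frac{d}{dx}$, act on the right on matrix-valued functions: $P(x)\cdot D=\sum_j \partial^j(P)(x)F_j(x)$; the product satisfies $P\cdot(D_1D_2)=(P\cdot D_1)\cdot D_2$. $\operatorname{Mat}_N(\Omega[x])$ is the algebra of such operators with all $F_j\in\operatorname{Mat}_N(\mathbb C)[x]$. For a weight matrix $W$ of size $N$ on an interval (smooth, positive definite almost everywhere, with finite moments), put $\langle P,Q\rangle=\int P(x)W(x)Q(x)^*\,dx$. The monic orthogonal polynomials $P_n$ are those with leading coefficient $I$, degree $n$, and $\langle P_n,P_m\rangle=0$ for $n\neq m$; $\mathcal D(W)$ is the algebra of all $D\in\operatorname{Mat}_N(\Omega[x])$ such that for every $n\ge0$ there is $\Lambda_n(D)\in\operatorname{Mat}_N(\mathbb C)$ with $P_n\cdot D=\Lambda_n(D)P_n$. An operator $D\in\mathcal D(W)$ is $W$-symmetric if $\langle P\cdot D,Q\rangle=\langle P,Q\cdot D\rangle$ for all $P,Q\in\operatorname{Mat}_N(\mathbb C)[x]$. For a weight matrix $W$ of size $N\times N$, the algebra $\mathcal D(W)$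 is full if there exist nonzero $W$-symmetric operators $\mathfrak D_1,\dots,\mathfrak D_N\in\mathcal D(W)$ such that $\mathfrak D_i\mathfrak D_j=0$ for $i\ne j$, and $\mathfrak D_1+\cdots+\mathfrak D_N$ belongs to the center $\mathcal Z(W)$ of $\mathcal D(W)$ and is not a zero divisor. *)

theory Defs
  imports
    "HOL-Analysis.Analysis"
    "HOL-Computational_Algebra.Polynomial"
    "HOL-Library.Poly_Mapping"
begin

text \<open>
  \<open>Mat\<^sub>N(\<complex>)[x]\<close> is identified with the N by N matrices over \<open>\<complex>[x]\<close>, where
  \<open>N = CARD('n)\<close>.  Matrix multiplication is always \<open>**\<close>; the class operation
  \<open>*\<close> on vectors is componentwise and is never used on matrices.
\<close>

type_synonym 'n mpoly = "complex poly ^ 'n ^ 'n"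

definition mpderiv :: "'n::finite mpoly \<Rightarrow> 'n mpoly" where
  "mpderiv P = (\<chi> i j. pderiv (P $ i $ j))"

definition mpconst :: "complex ^ 'n ^ 'n \<Rightarrow> 'n::finite mpoly" where
  "mpconst A = (\<chi> i j. [:A $ i $ j:])"

definition mpcoeff :: "'n::finite mpoly \<Rightarrow> nat \<Rightarrow> complex ^ 'n ^ 'n" where
  "mpcoeff P m = (\<chi> i j. coeff (P $ i $ j) m)"

definition mpeval :: "'n::finite mpoly \<Rightarrow> real \<Rightarrow> complex ^ 'n ^ 'n" where
  "mpeval P x = (\<chi> i j. poly (P $ i $ j) (complex_of_real x))"

definition ctranspose :: "complex ^ 'n ^ 'm \<Rightarrow> complex ^ 'm::finite ^ 'n::finite" where
  "ctranspose A = (\<chi> i j. cnj (A $ j $ i))"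

text \<open>
  The operator \<open>D = \<Sum>j. \<partial>\<^sup>j F\<^sub>j(x)\<close> is represented by the finitely supported family
  \<open>j \<mapsto> F\<^sub>j\<close>, so that \<open>0\<close>, \<open>+\<close> and sums are those of type \<open>poly_mapping\<close>.
  The product of operators is \<open>dop_mult\<close> below, \<^emph>\<open>not\<close> the convolution \<open>*\<close> of
  \<open>poly_mapping\<close>.
\<close>

type_synonym 'n diffop = "nat \<Rightarrow>\<^sub>0 'n mpoly"

definition dop_act :: "'n::finite mpoly \<Rightarrow> 'n diffop \<Rightarrow> 'n mpoly"  (infixl "\<lhd>" 70) where
  "P \<lhd> D = (\<Sum>j\<in>Poly_Mapping.keys D. (mpderiv ^^ j) P ** Poly_Mapping.lookup D j)"

text \<open>
  By the Leibniz rule,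
  \<open>(\<partial>\<^sup>i F)(\<partial>\<^sup>j G) = \<Sum>l\<le>j. (j choose l) \<partial>\<^sup>i\<^sup>+\<^sup>l F\<^sup>(\<^sup>j\<^sup>-\<^sup>l\<^sup>) G\<close>; the lemma \<open>dop_act_mult\<close>
  below confirms \<open>P \<cdot> (D\<^sub>1 D\<^sub>2) = (P \<cdot> D\<^sub>1) \<cdot> D\<^sub>2\<close>.
\<close>

definition dop_mult :: "'n::finite diffop \<Rightarrow> 'n diffop \<Rightarrow> 'n diffop"  (infixl "\<odot>" 70) where
  "D1 \<odot> D2 =
     (\<Sum>i\<in>Poly_Mapping.keys D1. \<Sum>j\<in>Poly_Mapping.keys D2. \<Sum>l\<le>j.
        Poly_Mapping.single (i + l)
          (mat (of_nat (j choose l)) ** (mpderiv ^^ (j - l)) (Poly_Mapping.lookup D1 i)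
             ** Poly_Mapping.lookup D2 j))"

lemma mpderiv_add: "mpderiv (P + Q) = mpderiv P + mpderiv Q"
  by (simp add: mpderiv_def vec_eq_iff pderiv_add)

lemma mpderiv_zero [simp]: "mpderiv 0 = 0"
  by (simp add: mpderiv_def vec_eq_iff)

lemma pderiv_sum_fun: "pderiv (\<Sum>x\<in>A. f x) = (\<Sum>x\<in>A. pderiv (f x))"
  by (induction A rule: infinite_finite_induct) (auto simp: pderiv_add)

lemma mpderiv_mult: "mpderiv (P ** Q) = mpderiv P ** Q + P ** mpderiv Q"
  by (simp add: mpderiv_def vec_eq_iff matrix_matrix_mult_def pderiv_sum_fun pderiv_mult
      sum.distrib algebra_simps)

lemma funpow_mpderiv_add: "(mpderiv ^^ j) (P + Q) = (mpderiv ^^ j) P + (mpderiv ^^ j) Q"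
  by (induction j) (auto simp: mpderiv_add)

lemma funpow_mpderiv_zero [simp]: "(mpderiv ^^ j) 0 = 0"
  by (induction j) auto

lemma funpow_mpderiv_sum: "(mpderiv ^^ j) (\<Sum>x\<in>A. f x) = (\<Sum>x\<in>A. (mpderiv ^^ j) (f x))"
  by (induction A rule: infinite_finite_induct) (auto simp: funpow_mpderiv_add)

lemma matrix_mult_sum_left: "A ** (\<Sum>x\<in>S. f x) = (\<Sum>x\<in>S. A ** f x)"
  by (induction S rule: infinite_finite_induct) (auto simp: matrix_add_ldistrib)

lemma matrix_add_rdistrib': "(B + C) ** A = B ** A + C ** A"
  by (simp add: vec_eq_iff matrix_matrix_mult_def sum.distrib algebra_simps)

lemma matrix_mult_sum_right: "(\<Sum>x\<in>S. f x) ** A = (\<Sum>x\<in>S. f x ** A)"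
  by (induction S rule: infinite_finite_induct) (auto simp: matrix_add_rdistrib')

lemma mat_nth_mult: "(mat c ** A) $ i $ j = c * A $ i $ j"
  by (simp add: matrix_matrix_mult_def mat_def if_distrib[of "\<lambda>u. u * _"] cong: if_cong)

lemma mat_mult_commute: "mat c ** A = A ** mat (c :: 'a::comm_semiring_1)"
  by (simp add: vec_eq_iff matrix_matrix_mult_def mat_def if_distrib[of "\<lambda>u. u * _"]
      if_distrib[of "\<lambda>u. _ * u"] mult.commute cong: if_cong)

lemma mat_add_mult: "mat (a + b) ** A = mat a ** A + mat b ** A"
  by (simp add: vec_eq_iff mat_nth_mult algebra_simps)

lemma mpderiv_mat_of_nat_mult: "mpderiv (mat (of_nat c) ** A) = mat (of_nat c) ** mpderiv A"
  by (simp add: vec_eq_iff mat_nth_mult mpderiv_def pderiv_mult flip: of_nat_poly)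

lemma mpderiv_mat_of_nat [simp]: "mpderiv (mat (of_nat c)) = 0"
  by (simp add: vec_eq_iff mpderiv_def mat_def flip: of_nat_poly)

lemma mpderiv_leibniz:
  "(mpderiv ^^ n) (P ** Q) =
     (\<Sum>l\<le>n. mat (of_nat (n choose l)) ** ((mpderiv ^^ l) P ** (mpderiv ^^ (n - l)) Q))"
proof (induction n)
  case 0
  then show ?case by simp
next
  case (Suc n)
  let ?a = "\<lambda>l m. (mpderiv ^^ l) P ** (mpderiv ^^ m) Q"
  let ?c = "\<lambda>l. mat (of_nat (n choose l)) :: 'a mpoly"
  have sum_d: "mpderiv (\<Sum>l\<in>A. f l) = (\<Sum>l\<in>A. mpderiv (f l))" for A and f :: "nat \<Rightarrow> 'a mpoly"
    using funpow_mpderiv_sum[of 1] by simp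
  have "(mpderiv ^^ Suc n) (P ** Q)
      = (\<Sum>l\<le>n. ?c l ** ?a (Suc l) (n - l) + ?c l ** ?a l (Suc (n - l)))"
    by (simp add: Suc sum_d mpderiv_mat_of_nat_mult mpderiv_mult matrix_add_ldistrib)
  also have "\<dots> = (\<Sum>l\<le>n. ?c l ** ?a (Suc l) (n - l)) + (\<Sum>l\<le>n. ?c l ** ?a l (Suc n - l))"
    by (simp add: sum.distrib Suc_diff_le)
  also have "(\<Sum>l\<le>n. ?c l ** ?a l (Suc n - l)) = (\<Sum>l\<le>Suc n. ?c l ** ?a l (Suc n - l))"
    by (simp add: vec_eq_iff mat_nth_mult)
  also have "\<dots> = ?a 0 (Suc n) + (\<Sum>l\<le>n. ?c (Suc l) ** ?a (Suc l) (n - l))"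
    by (subst sum.atMost_Suc_shift) simp
  also have "(\<Sum>l\<le>n. ?c l ** ?a (Suc l) (n - l))
        + (?a 0 (Suc n) + (\<Sum>l\<le>n. ?c (Suc l) ** ?a (Suc l) (n - l)))
      = ?a 0 (Suc n) + (\<Sum>l\<le>n. mat (of_nat (Suc n choose Suc l)) ** ?a (Suc l) (n - l))"
    by (simp add: sum.distrib mat_add_mult add_ac)
  also have "\<dots> = (\<Sum>l\<le>Suc n. mat (of_nat (Suc n choose l)) ** ?a l (Suc n - l))"
    by (subst sum.atMost_Suc_shift) simp
  finally show ?case .
qed

lemma dop_act_superset:
  assumes "finite S" "Poly_Mapping.keys D \<subseteq> S"
  shows "P \<lhd> D = (\<Sum>j\<in>S. (mpderiv ^^ j) P ** Poly_Mapping.lookup D j)"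
  unfolding dop_act_def using assms
  by (intro sum.mono_neutral_left) (auto simp: in_keys_iff)

lemma dop_act_zero [simp]: "P \<lhd> 0 = 0"
  by (simp add: dop_act_def)

lemma dop_act_add: "P \<lhd> (D + E) = P \<lhd> D + P \<lhd> E"
proof -
  let ?S = "Poly_Mapping.keys D \<union> Poly_Mapping.keys E"
  have "Poly_Mapping.keys (D + E) \<subseteq> ?S" by (rule Poly_Mapping.keys_add)
  then show ?thesis
    by (simp add: dop_act_superset[of ?S] lookup_add matrix_add_ldistrib sum.distrib)
qed

lemma dop_act_sum: "P \<lhd> (\<Sum>x\<in>A. f x) = (\<Sum>x\<in>A. P \<lhd> f x)"
  by (induction A rule: infinite_finite_induct) (auto simp: dop_act_add)

lemma dop_act_single: "P \<lhd> Poly_Mapping.single m F = (mpderiv ^^ m) P ** F"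
  by (subst dop_act_superset[of "{m}"]) auto

lemma dop_act_mult: "P \<lhd> (D1 \<odot> D2) = P \<lhd> D1 \<lhd> D2"
proof -
  have "P \<lhd> D1 \<lhd> D2 = (\<Sum>j\<in>Poly_Mapping.keys D2. \<Sum>i\<in>Poly_Mapping.keys D1. \<Sum>l\<le>j.
      mat (of_nat (j choose l)) ** ((mpderiv ^^ l) ((mpderiv ^^ i) P)
        ** (mpderiv ^^ (j - l)) (Poly_Mapping.lookup D1 i)) ** Poly_Mapping.lookup D2 j)"
    unfolding dop_act_def[of "P \<lhd> D1" D2] unfolding dop_act_def
    by (simp only: funpow_mpderiv_sum mpderiv_leibniz matrix_mult_sum_right)
  also have "\<dots> = P \<lhd> (D1 \<odot> D2)"
    unfolding dop_mult_def dop_act_sum dop_act_single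
  proof (subst sum.swap[of _ "Poly_Mapping.keys D1" "Poly_Mapping.keys D2"], intro sum.cong refl)
    fix i j l :: nat
    let ?c = "mat (of_nat (j choose l)) :: 'a mpoly"
    let ?F = "(mpderiv ^^ (j - l)) (Poly_Mapping.lookup D1 i)"
    have "(mpderiv ^^ l) ((mpderiv ^^ i) P) = (mpderiv ^^ (i + l)) P"
      by (simp only: add.commute[of i l] funpow_add o_apply)
    then show "?c ** ((mpderiv ^^ l) ((mpderiv ^^ i) P) ** ?F) ** Poly_Mapping.lookup D2 j
        = (mpderiv ^^ (i + l)) P ** (?c ** ?F ** Poly_Mapping.lookup D2 j)"
      by (simp only: matrix_mul_assoc mat_mult_commute[of _ "(mpderiv ^^ (i + l)) P"])
  qed
  finally show ?thesis ..
qed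

text \<open>A weight is a function together with the interval \<open>I\<close> on which it lives; its values
  outside \<open>I\<close> are irrelevant.  The sequence \<open>G\<close> lists the successive derivatives of \<open>W\<close>.\<close>

definition smooth_on_interval :: "real set \<Rightarrow> (real \<Rightarrow> complex ^ 'n::finite ^ 'n) \<Rightarrow> bool" where
  "smooth_on_interval I W \<longleftrightarrow>
     (\<exists>G :: nat \<Rightarrow> real \<Rightarrow> complex ^ 'n ^ 'n. (\<forall>x\<in>I. G 0 x = W x) \<and>
        (\<forall>m. \<forall>x\<in>I. (G m has_vector_derivative G (Suc m) x) (at x within I)))"

definition pos_def :: "complex ^ 'n::finite ^ 'n \<Rightarrow> bool" where
  "pos_def A \<longleftrightarrow> ctranspose A = A \<and>
     (\<forall>v. v \<noteq> 0 \<longrightarrow> 0 < Re (\<Sum>i\<in>UNIV. \<Sum>j\<in>UNIV. v $ i * A $ i $ j * cnj (v $ j)))"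

definition weight_matrix :: "real set \<Rightarrow> (real \<Rightarrow> complex ^ 'n::finite ^ 'n) \<Rightarrow> bool" where
  "weight_matrix I W \<longleftrightarrow>
     is_interval I \<and> interior I \<noteq> {} \<and> smooth_on_interval I W \<and>
     (AE x in lborel. x \<in> I \<longrightarrow> pos_def (W x)) \<and>
     (\<forall>m. set_integrable lborel I (\<lambda>x. x ^ m *\<^sub>R W x))"

definition inner_W ::
    "real set \<Rightarrow> (real \<Rightarrow> complex ^ 'n::finite ^ 'n) \<Rightarrow> 'n mpoly \<Rightarrow> 'n mpoly \<Rightarrow> complex ^ 'n ^ 'n" where
  "inner_W I W P Q =
     (\<chi> i j. LINT x:I|lborel. (mpeval P x ** W x ** ctranspose (mpeval Q x)) $ i $ j)"

definition is_monic_ops ::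
    "real set \<Rightarrow> (real \<Rightarrow> complex ^ 'n::finite ^ 'n) \<Rightarrow> (nat \<Rightarrow> 'n mpoly) \<Rightarrow> bool" where
  "is_monic_ops I W P \<longleftrightarrow>
     (\<forall>n. mpcoeff (P n) n = mat 1 \<and> (\<forall>m>n. mpcoeff (P n) m = 0)) \<and>
     (\<forall>n m. n \<noteq> m \<longrightarrow> inner_W I W (P n) (P m) = 0)"

text \<open>The description is meaningful because a weight matrix has exactly one sequence of monic
  orthogonal polynomials; \<open>weight_matrix_jacobi_W\<close> below shows that \<open>jacobi_W\<close> is one.\<close>

definition monic_ops ::
    "real set \<Rightarrow> (real \<Rightarrow> complex ^ 'n::finite ^ 'n) \<Rightarrow> nat \<Rightarrow> 'n mpoly" where
  "monic_ops I W = (THE P. is_monic_ops I W P)"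

definition alg_D ::
    "real set \<Rightarrow> (real \<Rightarrow> complex ^ 'n::finite ^ 'n) \<Rightarrow> 'n diffop set" where
  "alg_D I W = {D. \<forall>n. \<exists>\<Lambda>. monic_ops I W n \<lhd> D = mpconst \<Lambda> ** monic_ops I W n}"

definition center_D ::
    "real set \<Rightarrow> (real \<Rightarrow> complex ^ 'n::finite ^ 'n) \<Rightarrow> 'n diffop set" where
  "center_D I W = {D \<in> alg_D I W. \<forall>E \<in> alg_D I W. D \<odot> E = E \<odot> D}"

definition W_symmetric ::
    "real set \<Rightarrow> (real \<Rightarrow> complex ^ 'n::finite ^ 'n) \<Rightarrow> 'n diffop \<Rightarrow> bool" where
  "W_symmetric I W D \<longleftrightarrow> (\<forall>P Q. inner_W I W (P \<lhd> D) Q = inner_W I W P (Q \<lhd> D))"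

definition zero_divisor_D ::
    "real set \<Rightarrow> (real \<Rightarrow> complex ^ 'n::finite ^ 'n) \<Rightarrow> 'n diffop \<Rightarrow> bool" where
  "zero_divisor_D I W D \<longleftrightarrow> (\<exists>E \<in> alg_D I W. E \<noteq> 0 \<and> (D \<odot> E = 0 \<or> E \<odot> D = 0))"

definition commutative_D :: "real set \<Rightarrow> (real \<Rightarrow> complex ^ 'n::finite ^ 'n) \<Rightarrow> bool" where
  "commutative_D I W \<longleftrightarrow> (\<forall>D \<in> alg_D I W. \<forall>E \<in> alg_D I W. D \<odot> E = E \<odot> D)"

text \<open>The operators \<open>\<DD>\<^sub>1, \<dots>, \<DD>\<^sub>N\<close> are indexed by the type \<open>'n\<close>, which has \<open>N\<close> elements.\<close>

definition full_D :: "real set \<Rightarrow> (real \<Rightarrow> complex ^ 'n::finite ^ 'n) \<Rightarrow> bool" where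
  "full_D I W \<longleftrightarrow>
     (\<exists>\<DD> :: 'n \<Rightarrow> 'n diffop.
        (\<forall>i. \<DD> i \<in> alg_D I W \<and> \<DD> i \<noteq> 0 \<and> W_symmetric I W (\<DD> i)) \<and>
        (\<forall>i j. i \<noteq> j \<longrightarrow> \<DD> i \<odot> \<DD> j = 0) \<and>
        (\<Sum>i\<in>UNIV. \<DD> i) \<in> center_D I W \<and>
        \<not> zero_divisor_D I W (\<Sum>i\<in>UNIV. \<DD> i))"

definition jacobi_W :: "real \<Rightarrow> real \<Rightarrow> real \<Rightarrow> real \<Rightarrow> complex ^ 2 ^ 2" where
  "jacobi_W \<alpha> \<beta> k x = ((1 - x) powr \<alpha> * (1 + x) powr \<beta>) *\<^sub>R
     vector [vector [of_real (4 * (\<alpha> + 1) - 2 * k * (1 - x)), of_real (2 * (\<alpha> + 1 - k) * (1 - x))],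
             vector [of_real (2 * (\<alpha> + 1 - k) * (1 - x)), of_real ((\<alpha> + 1 - k) * (1 - x)\<^sup>2)]]"

lemma smooth_jacobi_scalar:
  fixes a b :: real and p :: "real poly"
  shows "\<exists>g :: nat \<Rightarrow> real \<Rightarrow> real. (\<forall>x. g 0 x = (1 - x) powr a * (1 + x) powr b * poly p x) \<and>
    (\<forall>m. \<forall>x\<in>{-1<..<1}. (g m has_real_derivative g (Suc m) x) (at x))"
proof -
  define step where "step m q =
      (smult (b - real m) [:1, -1:] - smult (a - real m) [:1, 1:]) * q + [:1, 0, -1:] * pderiv q"
    for m and q :: "real poly"
  define q where "q = rec_nat p step"
  have q: "q 0 = p" "\<And>m. q (Suc m) = step m (q m)" by (simp_all add: q_def)
  define g where "g m x = (1 - x) powr (a - real m) * (1 + x) powr (b - real m) * poly (q m) x"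
    for m and x :: real
  have "(g m has_real_derivative g (Suc m) x) (at x)" if x: "x \<in> {-1<..<1}" for m x
  proof -
    have A: "((\<lambda>x. (1 - x) powr c) has_real_derivative - (c * (1 - x) powr (c - 1))) (at x)" for c
      using x by (auto intro!: derivative_eq_intros)
    have B: "((\<lambda>x. (1 + x) powr c) has_real_derivative c * (1 + x) powr (c - 1)) (at x)" for c
      using x by (auto intro!: derivative_eq_intros)
    let ?c = "a - real m" and ?d = "b - real m"
    define u where "u = (1 - x) powr (?c - 1)"
    define v where "v = (1 + x) powr (?d - 1)"
    have u: "(1 - x) powr ?c = (1 - x) * u" and v: "(1 + x) powr ?d = (1 + x) * v"
      using x by (simp_all add: u_def v_def powr_diff)
    have "(g m has_real_derivative
        (- (?c * u) * (1 + x) powr ?d + ?d * v * (1 - x) powr ?c) * poly (q m) x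
          + poly (pderiv (q m)) x * ((1 - x) powr ?c * (1 + x) powr ?d)) (at x)"
      unfolding g_def[abs_def] u_def v_def
      by (intro DERIV_mult A B poly_DERIV)
    moreover have "g (Suc m) x = u * v * poly (step m (q m)) x"
      by (simp add: g_def q u_def v_def algebra_simps)
    moreover have "(- (?c * u) * ((1 + x) * v) + ?d * v * ((1 - x) * u)) * poly (q m) x
          + poly (pderiv (q m)) x * ((1 - x) * u * ((1 + x) * v)) = u * v * poly (step m (q m)) x"
      unfolding step_def poly_add poly_mult poly_diff poly_smult poly_pCons poly_0
      by (simp add: algebra_simps)
    ultimately show ?thesis
      unfolding u v by simp
  qed
  moreover have "g 0 x = (1 - x) powr a * (1 + x) powr b * poly p x" for x
    by (simp add: g_def q)
  ultimately show ?thesis by blast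
qed

lemma integrable_jacobi_scalar:
  fixes a b :: real
  assumes "a > -1" "b > -1"
  shows "set_integrable lborel {-1<..<1} (\<lambda>x. (1 - x) powr a * (1 + x) powr b * x ^ m)"
proof -
  have "integrable lborel
      (\<lambda>t. indicator {0..1} t *\<^sub>R (t powr b * (1 - t) powr a))"
    using integrable_Beta[of "b + 1" "a + 1"] assms by (simp add: set_integrable_def)
  from lborel_integrable_real_affine[OF this, of "1/2" "1/2"]
  have "integrable lborel (\<lambda>x. indicator {0..1} (1/2 + 1/2 * x) *\<^sub>R
      ((1/2 + 1/2 * x) powr b * (1 - (1/2 + 1/2 * x)) powr a))"
    by simp
  then have "integrable lborel (\<lambda>x. 2 powr (a + b) * (indicator {0..1} (1/2 + 1/2 * x) *\<^sub>R
      ((1/2 + 1/2 * x) powr b * (1 - (1/2 + 1/2 * x)) powr a)))"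
    by (rule integrable_mult_right)
  moreover have "(\<lambda>x::real. 2 powr (a + b) * (indicator {0..1} (1/2 + 1/2 * x) *\<^sub>R
      ((1/2 + 1/2 * x) powr b * (1 - (1/2 + 1/2 * x)) powr a)))
     = (\<lambda>x. indicator {-1..1} x *\<^sub>R ((1 - x) powr a * (1 + x) powr b))"
  proof
    fix x :: real
    show "2 powr (a + b) * (indicator {0..1} (1/2 + 1/2 * x) *\<^sub>R
      ((1/2 + 1/2 * x) powr b * (1 - (1/2 + 1/2 * x)) powr a))
       = indicator {-1..1} x *\<^sub>R ((1 - x) powr a * (1 + x) powr b)"
    proof (cases "x \<in> {-1..1}")
      case True
      have e: "(1/2 + 1/2 * x) = (1 + x) / 2" "1 - (1 + x) / 2 = (1 - x) / 2"
        by (simp_all add: field_simps)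
      from True have 1: "((1 + x) / 2) powr b = (1 + x) powr b / 2 powr b"
        "((1 - x) / 2) powr a = (1 - x) powr a / 2 powr a"
        by (simp_all only: powr_divide atLeastAtMost_iff)
      have 2: "(1 + x) / 2 \<in> {0..1} \<longleftrightarrow> x \<in> {-1..1}"
        by auto
      have "(2::real) powr (a + b) * ((1 + x) powr b / 2 powr b * ((1 - x) powr a / 2 powr a))
          = (1 - x) powr a * (1 + x) powr b"
        by (simp add: powr_add)
      with True 2 show ?thesis
        unfolding e 1 by (simp only: indicator_simps scaleR_one)
    qed (auto simp: indicator_def)
  qed
  ultimately have "set_integrable lborel {-1..1} (\<lambda>x. (1 - x) powr a * (1 + x) powr b)"
    unfolding set_integrable_def by (simp only:)
  then have "set_integrable lborel {-1<..<1} (\<lambda>x. (1 - x) powr a * (1 + x) powr b)"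
    by (rule set_integrable_subset) auto
  then show ?thesis
  proof (rule set_integrable_bound)
    show "AE x in lborel. x \<in> {-1<..<1} \<longrightarrow>
        norm ((1 - x) powr a * (1 + x) powr b * x ^ m) \<le> norm ((1 - x) powr a * (1 + x) powr b)"
    proof (intro AE_I2 impI)
      fix x :: real assume "x \<in> {-1<..<1}"
      then have "\<bar>x\<bar> ^ m \<le> 1" by (intro power_le_one) auto
      then have "\<bar>(1 - x) powr a * (1 + x) powr b\<bar> * \<bar>x\<bar> ^ m \<le> \<bar>(1 - x) powr a * (1 + x) powr b\<bar>"
        by (rule mult_left_le) simp
      then show "norm ((1 - x) powr a * (1 + x) powr b * x ^ m)
          \<le> norm ((1 - x) powr a * (1 + x) powr b)"
        by (simp only: real_norm_def abs_mult power_abs)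
    qed
  qed (auto simp: set_borel_measurable_def)
qed

lemma weight_matrix_jacobi_W:
  assumes "\<alpha> > -1" "\<beta> > -1" "0 < k" "k < \<alpha> + 1"
  shows "weight_matrix {-1<..<1} (jacobi_W \<alpha> \<beta> k)"
proof -
  define w where "w x = (1 - x) powr \<alpha> * (1 + x) powr \<beta>" for x
  define c where "c = \<alpha> + 1 - k"
  define A0 A1 A2 :: "complex^2^2" where
    "A0 = vector [vector [of_real (4 * (\<alpha> + 1) - 2 * k), of_real (2 * c)],
                  vector [of_real (2 * c), of_real c]]" and
    "A1 = vector [vector [of_real (2 * k), of_real (- 2 * c)],
                  vector [of_real (- 2 * c), of_real (- 2 * c)]]" and
    "A2 = vector [vector [0, 0], vector [0, of_real c]]"
  have W: "jacobi_W \<alpha> \<beta> k x = (w x * x ^ 0) *\<^sub>R A0 + (w x * x ^ 1) *\<^sub>R A1 + (w x * x ^ 2) *\<^sub>R A2" for x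
    unfolding jacobi_W_def w_def[symmetric]
    by (simp add: vec_eq_iff forall_2 A0_def A1_def A2_def c_def complex_eq_iff
        algebra_simps power2_eq_square)
  have "\<exists>g. (\<forall>x. g 0 x = w x * x ^ n) \<and>
      (\<forall>m. \<forall>x\<in>{-1<..<1}. (g m has_real_derivative g (Suc m) x) (at x))" for n
    using smooth_jacobi_scalar[of \<alpha> \<beta> "monom 1 n"] by (simp add: w_def poly_monom)
  then obtain g where g0: "\<And>n x. g n 0 x = w x * x ^ n"
    and g: "\<And>n m x. x \<in> {-1<..<1} \<Longrightarrow> (g n m has_real_derivative g n (Suc m) x) (at x)"
    by metis
  have "smooth_on_interval {-1<..<1} (jacobi_W \<alpha> \<beta> k)"
    unfolding smooth_on_interval_def
  proof (intro exI[of _ "\<lambda>m x. g 0 m x *\<^sub>R A0 + g 1 m x *\<^sub>R A1 + g 2 m x *\<^sub>R A2"] conjI allI ballI)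
    fix x assume x: "x \<in> {-1<..<1::real}"
    show "g 0 0 x *\<^sub>R A0 + g 1 0 x *\<^sub>R A1 + g 2 0 x *\<^sub>R A2 = jacobi_W \<alpha> \<beta> k x"
      by (simp add: W g0)
    fix m
    have "((\<lambda>x. g n m x *\<^sub>R A) has_vector_derivative g n (Suc m) x *\<^sub>R A) (at x within {-1<..<1})"
      for n and A :: "complex^2^2"
      using has_vector_derivative_scaleR[OF
          has_field_derivative_at_within[OF g[OF x]] has_vector_derivative_const[of A]]
      by simp
    then show "((\<lambda>x. g 0 m x *\<^sub>R A0 + g 1 m x *\<^sub>R A1 + g 2 m x *\<^sub>R A2) has_vector_derivative
        g 0 (Suc m) x *\<^sub>R A0 + g 1 (Suc m) x *\<^sub>R A1 + g 2 (Suc m) x *\<^sub>R A2) (at x within {-1<..<1})"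
      by (intro has_vector_derivative_add)
  qed
  moreover have "pos_def (jacobi_W \<alpha> \<beta> k x)" if x: "x \<in> {-1<..<1}" for x
  proof -
    define y where "y = 1 - x"
    have y: "0 < y" "y < 2" and c: "0 < c" and wx: "0 < w x"
      using x assms by (auto simp: y_def c_def w_def)
    have J: "jacobi_W \<alpha> \<beta> k x = w x *\<^sub>R
        vector [vector [of_real (4 * (\<alpha> + 1) - 2 * k * y), of_real (2 * c * y)],
                vector [of_real (2 * c * y), of_real (c * y\<^sup>2)]]"
      by (simp add: jacobi_W_def w_def y_def c_def)
    have "0 < Re (\<Sum>i\<in>UNIV. \<Sum>j\<in>UNIV. v $ i * jacobi_W \<alpha> \<beta> k x $ i $ j * cnj (v $ j))"
      if v: "v \<noteq> 0" for v :: "complex^2"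
    proof -
      obtain p q r s where pq: "v $ 1 = Complex p q" and rs: "v $ 2 = Complex r s"
        by (metis complex.exhaust)
      have ne: "p \<noteq> 0 \<or> q \<noteq> 0 \<or> r \<noteq> 0 \<or> s \<noteq> 0"
        using v pq rs by (auto simp: vec_eq_iff forall_2 complex_eq_iff)
      have "Re (\<Sum>i\<in>UNIV. \<Sum>j\<in>UNIV. v $ i * jacobi_W \<alpha> \<beta> k x $ i $ j * cnj (v $ j))
          = w x * (c * ((2 * p + y * r)\<^sup>2 + (2 * q + y * s)\<^sup>2) + 2 * k * (2 - y) * (p\<^sup>2 + q\<^sup>2))"
        unfolding J
        by (simp add: sum_2 pq rs c_def algebra_simps power2_eq_square)
      moreover have "0 < c * ((2 * p + y * r)\<^sup>2 + (2 * q + y * s)\<^sup>2) + 2 * k * (2 - y) * (p\<^sup>2 + q\<^sup>2)"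
      proof (cases "p = 0 \<and> q = 0")
        case True
        with ne y c show ?thesis
          by (auto simp: sum_power2_gt_zero_iff)
      next
        case False
        then have "0 < 2 * k * (2 - y) * (p\<^sup>2 + q\<^sup>2)"
          using y assms by (simp add: sum_power2_gt_zero_iff)
        moreover have "0 \<le> c * ((2 * p + y * r)\<^sup>2 + (2 * q + y * s)\<^sup>2)"
          using c by simp
        ultimately show ?thesis by linarith
      qed
      ultimately show ?thesis using wx by simp
    qed
    moreover have "ctranspose (jacobi_W \<alpha> \<beta> k x) = jacobi_W \<alpha> \<beta> k x"
      by (simp add: ctranspose_def jacobi_W_def vec_eq_iff forall_2)
    ultimately show ?thesis by (auto simp: pos_def_def)
  qed
  moreover have "set_integrable lborel {-1<..<1} (\<lambda>x. x ^ m *\<^sub>R jacobi_W \<alpha> \<beta> k x)" for m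
  proof -
    have "set_integrable lborel {-1<..<1} (\<lambda>x. (w x * x ^ n) *\<^sub>R A)" for n and A :: "complex^2^2"
      using integrable_jacobi_scalar[OF assms(1,2), of n] by (simp add: w_def)
    then have "set_integrable lborel {-1<..<1} (\<lambda>x. (w x * x ^ (m + 0)) *\<^sub>R A0
        + (w x * x ^ (m + 1)) *\<^sub>R A1 + (w x * x ^ (m + 2)) *\<^sub>R A2)"
      by (intro set_integral_add)
    moreover have "(\<lambda>x. (w x * x ^ (m + 0)) *\<^sub>R A0
        + (w x * x ^ (m + 1)) *\<^sub>R A1 + (w x * x ^ (m + 2)) *\<^sub>R A2)
       = (\<lambda>x. x ^ m *\<^sub>R jacobi_W \<alpha> \<beta> k x)"
      by (simp add: W fun_eq_iff scaleR_add_right power_add power2_eq_square mult_ac)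
    ultimately show ?thesis by simp
  qed
  ultimately show ?thesis
    by (auto simp: weight_matrix_def is_interval_oo interior_open)
qed

end

theory Submission
  imports Defs
begin

text \<open>The weight factors as \<open>W = T diag(\<dots>) T\<^sup>*\<close>: writing a row \<open>(p\<^sub>1, p\<^sub>2)\<close> as \<open>f = 2 p\<^sub>1 + (1 - x) p\<^sub>2\<close>
  and \<open>g = p\<^sub>1\<close>, its square norm is a positive combination of those of \<open>f\<close> and \<open>g\<close> for the scalar Jacobi weights with
  parameters \<open>(\<alpha>, \<beta>)\<close> and \<open>(\<alpha>, \<beta> + 1)\<close>, and the polynomial rows are the pairs with \<open>f(1) = 2 g(1)\<close>.
  There are a first order operator \<open>A\<close> on rows and a first order operator \<open>B\<close>, which is, up to positive
  constants, its adjoint from the direct sum of the scalar Jacobi weights \<open>(\<alpha> + 1, \<beta> + 1)\<close> and \<open>(\<alpha> + 1, \<beta>)\<close>.  The product \<open>A B\<close>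
  (first \<open>A\<close>, then \<open>B\<close>) is diagonal, with entries a constant minus the two scalar Jacobi operators.  Hence \<open>A\<close> maps
  \<open>diag(r\<^sub>n, q\<^sub>n)\<close>, made of the Jacobi polynomials of the two families, to a matrix polynomial \<open>\<Psi>\<^sub>n\<close> of
  degree \<open>n\<close>, orthogonal to all lower degrees, with invertible leading coefficient.  So \<open>\<Psi>\<^sub>n\<close> is a
  constant multiple of \<open>P\<^sub>n\<close>, and \<open>\<D>(W)\<close> consists of the operators that act on each \<open>\<Psi>\<^sub>n\<close> as a constant
  matrix.

  Commutativity.  Let \<open>E \<in> \<D>(W)\<close> act on \<open>\<Psi>\<^sub>n\<close> as the matrix \<open>M\<^sub>n\<close>.  The off-diagonal entries of the
  operator \<open>A E B\<close> are scalar operators that map \<open>r\<^sub>n\<close> to a multiple of \<open>q\<^sub>n\<close> and conversely, the factor being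
  an off-diagonal entry of \<open>M\<^sub>n\<close> times a nonzero number.  At \<open>1\<close> and at \<open>-1\<close> the derivatives of \<open>r\<^sub>n\<close> are
  polynomials in the eigenvalue \<open>\<lambda>\<^sub>n\<close> times the value of \<open>r\<^sub>n\<close>, because the equation is singular there.
  Comparing the two ends, the ratio of two polynomials in \<open>\<lambda>\<^sub>n\<close>, whose degrees in \<open>n\<close> are even, would
  be the quotient of \<open>q\<^sub>n(1) / r\<^sub>n(1)\<close> by \<open>q\<^sub>n(-1) / r\<^sub>n(-1)\<close> or its inverse; but that quotient is a polynomial
  of degree one in \<open>n\<close>.  So the factor is \<open>0\<close>: every \<open>M\<^sub>n\<close> is diagonal (\<open>no_intertwiner\<close>, \<open>alg_D_diagonal\<close>).

  Fullness.  The operators \<open>\<DD>\<^sub>i = B E\<^sub>i\<^sub>i A\<close> are symmetric because \<open>B\<close> is the adjoint of \<open>A\<close>, up to positive constants.  On \<open>\<Psi>\<^sub>n\<close> they act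
  as \<open>\<tau>\<^sub>n\<^sub>i E\<^sub>i\<^sub>i\<close> with \<open>\<tau>\<^sub>n\<^sub>i > 0\<close>, so their products vanish and their sum acts invertibly.\<close>

section \<open>Operators are determined by their action\<close>

text \<open>The degree bound is strict, so that the bound \<open>0\<close> singles out the zero polynomial and can start
  an induction.\<close>

definition mdeg_less :: "nat \<Rightarrow> 'n::finite mpoly \<Rightarrow> bool" where
  "mdeg_less n P \<longleftrightarrow> (\<forall>m\<ge>n. mpcoeff P m = 0)"

lemma funpow_mpderiv_entry: "(mpderiv ^^ j) P $ a $ b = (pderiv ^^ j) (P $ a $ b)"
  by (induction j arbitrary: P) (simp_all add: mpderiv_def funpow_swap1)

lemma dop_act_entry:
  "(P \<lhd> D) $ a $ b = (\<Sum>j\<in>Poly_Mapping.keys D. \<Sum>l\<in>UNIV.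
     (pderiv ^^ j) (P $ a $ l) * Poly_Mapping.lookup D j $ l $ b)"
  by (simp add: dop_act_def matrix_matrix_mult_def funpow_mpderiv_entry)

lemma dop_act_add_left: "(P + Q) \<lhd> D = P \<lhd> D + Q \<lhd> D"
  by (simp add: dop_act_def funpow_mpderiv_add matrix_add_rdistrib' sum.distrib)

lemma dop_act_zero_left [simp]: "0 \<lhd> D = 0"
  by (simp add: dop_act_def vec_eq_iff matrix_matrix_mult_def)

lemma mpderiv_mpconst_mult: "mpderiv (mpconst A ** P) = mpconst A ** mpderiv P"
proof -
  have "mpderiv (mpconst A) = 0"
    by (simp add: mpderiv_def mpconst_def vec_eq_iff)
  moreover have "0 ** P = 0"
    by (simp add: vec_eq_iff matrix_matrix_mult_def)
  ultimately show ?thesis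
    by (simp add: mpderiv_mult)
qed

lemma dop_act_mpconst_mult: "(mpconst A ** P) \<lhd> D = mpconst A ** (P \<lhd> D)"
proof -
  have "(mpderiv ^^ j) (mpconst A ** P) = mpconst A ** (mpderiv ^^ j) P" for j
    by (induction j) (simp_all add: mpderiv_mpconst_mult)
  then show ?thesis
    by (simp add: dop_act_def matrix_mult_sum_left matrix_mul_assoc)
qed

lemma dop_act_diff: "P \<lhd> (D - E) = P \<lhd> D - P \<lhd> E"
  using dop_act_add[of P "D - E" E] by simp

lemma mpconst_mult: "mpconst A ** mpconst B = mpconst (A ** B)"
proof -
  have "(\<Sum>x\<in>S. [:f x:]) = [:\<Sum>x\<in>S. f x:]" for f :: "'a \<Rightarrow> complex" and S
    by (induction S rule: infinite_finite_induct) simp_all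
  then show ?thesis
    by (simp add: mpconst_def vec_eq_iff matrix_matrix_mult_def mult.commute)
qed

lemma mpconst_mat_1 [simp]: "mpconst (mat 1) = mat 1"
  by (simp add: mpconst_def mat_def vec_eq_iff one_pCons)

lemma mpconst_0 [simp]: "mpconst 0 = 0"
  by (simp add: mpconst_def vec_eq_iff)

lemma mpcoeff_mpconst_mult: "mpcoeff (mpconst A ** P) m = A ** mpcoeff P m"
  by (simp add: mpcoeff_def mpconst_def vec_eq_iff matrix_matrix_mult_def coeff_sum)

lemma mpcoeff_diff: "mpcoeff (P - Q) m = mpcoeff P m - mpcoeff Q m"
  by (simp add: mpcoeff_def vec_eq_iff)

lemma mdeg_less_0 [simp]: "mdeg_less 0 P \<longleftrightarrow> P = 0"
  by (auto simp: mdeg_less_def mpcoeff_def vec_eq_iff poly_eq_iff)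

lemma exists_mdeg_less: "\<exists>n. mdeg_less n P"
proof -
  define n where "n = (\<Sum>a\<in>UNIV. \<Sum>b\<in>UNIV. Suc (degree (P $ a $ b)))"
  have "degree (P $ a $ b) < n" for a b
  proof -
    have "Suc (degree (P $ a $ b)) \<le> (\<Sum>b\<in>UNIV. Suc (degree (P $ a $ b)))"
      by (rule member_le_sum) auto
    also have "\<dots> \<le> n"
      unfolding n_def by (rule member_le_sum) auto
    finally show ?thesis by simp
  qed
  then have "mdeg_less n P"
    unfolding mdeg_less_def mpcoeff_def vec_eq_iff
    by (auto intro!: coeff_eq_0 dest: less_le_trans)
  then show ?thesis ..
qed

text \<open>Subtracting the right constant multiple of \<open>\<Phi> n\<close> lowers the degree, so a property that is
  closed under these combinations passes from the sequence to all matrix polynomials.\<close>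

lemma mpoly_basis_induct:
  fixes \<Phi> :: "nat \<Rightarrow> 'n::finite mpoly"
  assumes deg: "\<And>n. n < N \<Longrightarrow> mdeg_less (Suc n) (\<Phi> n)"
    and inv: "\<And>n. n < N \<Longrightarrow> \<exists>L. L ** mpcoeff (\<Phi> n) n = mat 1"
    and zero: "Q 0"
    and step: "\<And>n A P. n < N \<Longrightarrow> Q P \<Longrightarrow> Q (mpconst A ** \<Phi> n + P)"
    and P: "mdeg_less N P"
  shows "Q P"
proof -
  have "mdeg_less d P \<Longrightarrow> d \<le> N \<Longrightarrow> Q P" for d
  proof (induction d arbitrary: P)
    case 0
    then show ?case using zero by simp
  next
    case (Suc d)
    then obtain L where L: "L ** mpcoeff (\<Phi> d) d = mat 1"
      using inv[of d] by auto
    define A where "A = mpcoeff P d ** L"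
    have "mpcoeff (P - mpconst A ** \<Phi> d) m = 0" if "m \<ge> d" for m
    proof (cases "m = d")
      case True
      then show ?thesis
        by (simp add: mpcoeff_diff mpcoeff_mpconst_mult A_def matrix_mul_assoc[symmetric] L)
    next
      case False
      with that Suc.prems deg[of d] have "mpcoeff P m = 0" "mpcoeff (\<Phi> d) m = 0"
        by (simp_all add: mdeg_less_def)
      then show ?thesis
        unfolding mpcoeff_diff mpcoeff_mpconst_mult
        by (simp add: vec_eq_iff matrix_matrix_mult_def)
    qed
    then have "Q (P - mpconst A ** \<Phi> d)"
      using Suc.IH Suc.prems by (simp add: mdeg_less_def)
    from step[OF _ this, of d A] Suc.prems show ?case by simp
  qed
  then show ?thesis using P by blast
qed

lemma higher_pderiv_monom_1:
  "(pderiv ^^ j) (monom 1 m :: complex poly) = (if j \<le> m then monom (fact m / fact (m - j)) (m - j) else 0)"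
proof (induction j)
  case (Suc j)
  show ?case
  proof (cases "j < m")
    case True
    then have "m - j = Suc (m - Suc j)" by simp
    with True Suc show ?thesis
      by (simp add: pderiv_monom fact_reduce[of "m - j"])
  next
    case False
    with Suc show ?thesis by (auto simp: pderiv_monom)
  qed
qed simp

text \<open>The matrix polynomial \<open>x\<^sup>j I\<close> isolates the coefficient of \<open>\<partial>\<^sup>j\<close> once the lower ones vanish.\<close>

lemma dop_eq_0I:
  fixes D :: "'n::finite diffop"
  assumes "\<And>P. P \<lhd> D = 0"
  shows "D = 0"
proof (rule ccontr)
  assume "D \<noteq> 0"
  then have ne: "Poly_Mapping.keys D \<noteq> {}" by simp
  define m where "m = Min (Poly_Mapping.keys D)"
  have m: "m \<in> Poly_Mapping.keys D" "\<And>j. j \<in> Poly_Mapping.keys D \<Longrightarrow> m \<le> j"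
    using ne by (auto simp: m_def)
  have pd: "(pderiv ^^ j) (monom 1 m :: complex poly) = (if j = m then [:fact m:] else 0)"
    if "j \<in> Poly_Mapping.keys D" for j
    using m(2)[OF that] by (auto simp: higher_pderiv_monom_1 monom_0)
  have "Poly_Mapping.lookup D m $ a $ b = 0" for a b
  proof -
    define P where "P = (mat (monom 1 m) :: 'n mpoly)"
    have P: "(pderiv ^^ j) (P $ a $ l) = (if l = a then (pderiv ^^ j) (monom 1 m) else 0)" for j l
      by (auto simp: P_def mat_def)
    have "0 = (P \<lhd> D) $ a $ b" using assms by simp
    also have "\<dots> = (\<Sum>j\<in>Poly_Mapping.keys D. (pderiv ^^ j) (monom 1 m) * Poly_Mapping.lookup D j $ a $ b)"
      by (simp add: dop_act_entry P if_distrib[of "\<lambda>u. u * _"] cong: if_cong)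
    also have "\<dots> = (\<Sum>j\<in>Poly_Mapping.keys D. if j = m then [:fact m:] * Poly_Mapping.lookup D j $ a $ b else 0)"
      by (rule sum.cong) (auto simp: pd)
    also have "\<dots> = [:fact m:] * Poly_Mapping.lookup D m $ a $ b"
      using m(1) by simp
    finally show ?thesis by simp
  qed
  then have "Poly_Mapping.lookup D m = 0"
    by (simp add: vec_eq_iff)
  with m(1) show False by (simp add: in_keys_iff)
qed

lemma dop_eqI_basis:
  fixes \<Phi> :: "nat \<Rightarrow> 'n::finite mpoly"
  assumes deg: "\<And>n. mdeg_less (Suc n) (\<Phi> n)"
    and inv: "\<And>n. \<exists>L. L ** mpcoeff (\<Phi> n) n = mat 1"
    and eq: "\<And>n. \<Phi> n \<lhd> D = \<Phi> n \<lhd> E"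
  shows "D = E"
proof -
  have "P \<lhd> (D - E) = 0" for P
  proof -
    obtain N where "mdeg_less N P" using exists_mdeg_less by blast
    from mpoly_basis_induct[of N \<Phi> "\<lambda>P. P \<lhd> (D - E) = 0" P, OF deg inv _ _ this] show ?thesis
      by (simp add: dop_act_add_left dop_act_mpconst_mult dop_act_diff eq)
  qed
  then have "D - E = 0" by (rule dop_eq_0I)
  then show ?thesis by simp
qed

section \<open>Jacobi polynomials\<close>

text \<open>The hypergeometric operator with weight \<open>(1 - x)\<^sup>a (1 + x)\<^sup>b\<close>.\<close>

definition jacobi_op :: "complex \<Rightarrow> complex \<Rightarrow> complex poly \<Rightarrow> complex poly" where
  "jacobi_op a b u = [:1, 0, -1:] * pderiv (pderiv u) + [:b - a, - (a + b + 2):] * pderiv u"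

text \<open>The sum is homogeneous in \<open>(x - 1)/2\<close> and \<open>(x + 1)/2\<close>, so each endpoint value is a single term.
  The normalization differs from the classical one by the factor \<open>(a + 1)\<^sub>n (b + 1)\<^sub>n / n!\<close>, which makes
  these two terms as simple as possible; the polynomials are not monic.\<close>

definition jacobi_poly :: "complex \<Rightarrow> complex \<Rightarrow> nat \<Rightarrow> complex poly" where
  "jacobi_poly a b n = (\<Sum>i\<le>n. smult (of_nat (n choose i) /
     (pochhammer (a + 1) i * pochhammer (b + 1) (n - i))) ([:-1/2, 1/2:] ^ i * [:1/2, 1/2:] ^ (n - i)))"

definition jacobi_eigenvalue :: "complex \<Rightarrow> complex \<Rightarrow> nat \<Rightarrow> complex" where
  "jacobi_eigenvalue a b n = - (of_nat n * (of_nat n + a + b + 1))"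

lemma poly_jacobi_poly_1: "poly (jacobi_poly a b n) 1 = 1 / pochhammer (b + 1) n"
proof -
  have "poly (jacobi_poly a b n) 1 = (\<Sum>i\<le>n. if i = 0 then 1 / pochhammer (b + 1) n else 0)"
    unfolding jacobi_poly_def poly_sum by (rule sum.cong) auto
  then show ?thesis by simp
qed

lemma poly_jacobi_poly_minus_1: "poly (jacobi_poly a b n) (-1) = (-1) ^ n / pochhammer (a + 1) n"
proof -
  have "poly (jacobi_poly a b n) (-1) = (\<Sum>i\<le>n. if i = n then (-1) ^ n / pochhammer (a + 1) n else 0)"
    unfolding jacobi_poly_def poly_sum by (rule sum.cong) auto
  then show ?thesis by simp
qed

lemma pochhammer_nonzero:
  assumes "\<And>j. z + 1 + of_nat j \<noteq> (0::complex)"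
  shows "pochhammer (z + 1) n \<noteq> 0"
  using assms by (metis pochhammer_eq_0_iff add.commute add.right_inverse)

lemma jacobi_op_add: "jacobi_op a b (u + v) = jacobi_op a b u + jacobi_op a b v"
  unfolding jacobi_op_def pderiv_add ring_distribs by (simp only: ac_simps)

lemma jacobi_op_smult: "jacobi_op a b (smult c u) = smult c (jacobi_op a b u)"
  by (simp add: jacobi_op_def pderiv_smult smult_add_right)

lemma smult_sum_right: "smult c (\<Sum>i\<in>A. f i) = (\<Sum>i\<in>A. smult c (f i))"
  by (induction A rule: infinite_finite_induct) (auto simp: smult_add_right)

lemma jacobi_op_sum: "jacobi_op a b (\<Sum>i\<in>A. f i) = (\<Sum>i\<in>A. jacobi_op a b (f i))"
  by (induction A rule: infinite_finite_induct) (auto simp: jacobi_op_add jacobi_op_def[of a b 0])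

text \<open>With \<open>u = (x - 1)/2\<close> and \<open>v = (x + 1)/2\<close> one has \<open>1 - x\<^sup>2 = -4 u v\<close>, and the first order coefficient is
  linear and homogeneous in \<open>u\<close> and \<open>v\<close>.  So the operator preserves forms of degree \<open>i + m\<close> and is
  tridiagonal on their monomials.\<close>

lemma jacobi_op_homogeneous:
  fixes a b :: complex and i m :: nat
  defines "u \<equiv> [:-1/2, 1/2:]" and "v \<equiv> [:1/2, 1/2:]"
  shows "jacobi_op a b (u ^ i * v ^ m) =
      - smult (of_nat i * (of_nat i + a)) (u ^ (i - 1) * v ^ Suc m)
      - smult (of_nat m * (of_nat m + b)) (u ^ Suc i * v ^ (m - 1))
      - smult (2 * of_nat i * of_nat m + (b + 1) * of_nat i + (a + 1) * of_nat m) (u ^ i * v ^ m)"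
proof -
  have du: "pderiv u = [:1/2:]" and dv: "pderiv v = [:1/2:]"
    by (simp_all add: u_def v_def pderiv_pCons)
  have d: "poly (jacobi_op a b (u ^ i * v ^ m)) x = - 4 * U * V * (
        of_nat i * (of_nat i - 1) / 4 * U ^ (i - 2) * V ^ m
        + of_nat i * of_nat m / 2 * U ^ (i - 1) * V ^ (m - 1)
        + of_nat m * (of_nat m - 1) / 4 * U ^ i * V ^ (m - 2))
      - ((b + 1) * U + (a + 1) * V)
        * (of_nat i * U ^ (i - 1) * V ^ m + of_nat m * U ^ i * V ^ (m - 1))"
    if U: "U = poly u x" and V: "V = poly v x" for x U V
  proof -
    have x: "1 - x * x = - 4 * (U * V)" "b - a - x * (a + b + 2) = - 2 * ((b + 1) * U + (a + 1) * V)"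
      by (simp_all add: U V u_def v_def field_simps)
    have c: "of_nat j * of_nat (j - 1) = of_nat j * (of_nat j - 1 :: complex)" for j
      by (cases j) auto
    have i: "i - Suc (Suc 0) = i - 2" "m - Suc (Suc 0) = m - 2" by auto
    have j1: "poly (pderiv (u ^ i * v ^ m)) x =
        (of_nat i * U ^ (i - 1) * V ^ m + of_nat m * U ^ i * V ^ (m - 1)) / 2"
      by (simp add: pderiv_mult pderiv_power du dv field_simps flip: U V)
    have j2: "poly (pderiv (pderiv (u ^ i * v ^ m))) x =
        of_nat i * of_nat (i - 1) / 4 * U ^ (i - 2) * V ^ m
        + of_nat i * of_nat m / 2 * U ^ (i - 1) * V ^ (m - 1)
        + of_nat m * of_nat (m - 1) / 4 * U ^ i * V ^ (m - 2)"
      by (simp add: pderiv_mult pderiv_power pderiv_add pderiv_smult du dv i field_simps flip: U V)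
    have j3: "poly (jacobi_op a b w) x = (1 - x * x) * poly (pderiv (pderiv w)) x
        + (b - a - x * (a + b + 2)) * poly (pderiv w) x" for w
      by (simp add: jacobi_op_def algebra_simps)
    have "- 4 * (U * V) * P + - 2 * Q * (S / 2) = - 4 * U * V * P - Q * S" for P Q S
      by simp
    then show ?thesis
      unfolding j3 x j1 j2 c .
  qed
  show ?thesis
  proof (rule poly_ext)
    fix x
    define U V where UV: "U = poly u x" "V = poly v x"
    show "poly (jacobi_op a b (u ^ i * v ^ m)) x = poly (- smult (of_nat i * (of_nat i + a)) (u ^ (i - 1) * v ^ Suc m)
      - smult (of_nat m * (of_nat m + b)) (u ^ Suc i * v ^ (m - 1))
      - smult (2 * of_nat i * of_nat m + (b + 1) * of_nat i + (a + 1) * of_nat m) (u ^ i * v ^ m)) x"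
      unfolding d[OF UV] poly_add poly_diff poly_minus poly_mult poly_smult poly_power UV[symmetric]
    proof -
      have "i = 0 \<or> i = 1 \<or> i = Suc (Suc (i - 2))" "m = 0 \<or> m = 1 \<or> m = Suc (Suc (m - 2))" by auto
      then show "- 4 * U * V * (
          of_nat i * (of_nat i - 1) / 4 * U ^ (i - 2) * V ^ m
          + of_nat i * of_nat m / 2 * U ^ (i - 1) * V ^ (m - 1)
          + of_nat m * (of_nat m - 1) / 4 * U ^ i * V ^ (m - 2))
        - ((b + 1) * U + (a + 1) * V)
          * (of_nat i * U ^ (i - 1) * V ^ m + of_nat m * U ^ i * V ^ (m - 1))
        = - (of_nat i * (of_nat i + a) * (U ^ (i - 1) * V ^ Suc m))
          - of_nat m * (of_nat m + b) * (U ^ Suc i * V ^ (m - 1))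
          - (2 * of_nat i * of_nat m + (b + 1) * of_nat i + (a + 1) * of_nat m) * (U ^ i * V ^ m)"
      proof (elim disjE)
        assume "i = Suc (Suc (i - 2))" "m = Suc (Suc (m - 2))"
        then obtain j l where "i = Suc (Suc j)" "m = Suc (Suc l)" by blast
        then show ?thesis by (simp add: field_simps)
      next
        assume "i = Suc (Suc (i - 2))" "m = 1"
        then obtain j where "i = Suc (Suc j)" by blast
        with \<open>m = 1\<close> show ?thesis by (simp add: field_simps)
      next
        assume "i = Suc (Suc (i - 2))" "m = 0"
        then obtain j where "i = Suc (Suc j)" by blast
        with \<open>m = 0\<close> show ?thesis by (simp add: field_simps)
      next
        assume "i = 0" "m = Suc (Suc (m - 2))"
        then obtain j where "m = Suc (Suc j)" by blast
        with \<open>i = 0\<close> show ?thesis by (simp add: field_simps)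
      next
        assume "i = 1" "m = Suc (Suc (m - 2))"
        then obtain j where "m = Suc (Suc j)" by blast
        with \<open>i = 1\<close> show ?thesis by (simp add: field_simps)
      qed (simp_all add: field_simps)
    qed
  qed
qed

text \<open>The coefficients satisfy a two-term recursion that turns each of the two outer diagonals of the
  tridiagonal action into a multiple of the monomial itself; the three contributions add up to the
  eigenvalue.\<close>

lemma jacobi_op_jacobi_poly:
  assumes a: "\<And>j. a + 1 + of_nat j \<noteq> 0" and b: "\<And>j. b + 1 + of_nat j \<noteq> 0"
  shows "jacobi_op a b (jacobi_poly a b n) = smult (jacobi_eigenvalue a b n) (jacobi_poly a b n)"
proof -
  define u v where "u = [:-1/2, 1/2 :: complex:]" and "v = [:1/2, 1/2 :: complex:]"
  define c where "c i = of_nat (n choose i) / (pochhammer (a + 1) i * pochhammer (b + 1) (n - i))" for i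
  define p where "p i = of_nat i * (of_nat i + a)" for i
  define q where "q i = of_nat (n - i) * (of_nat (n - i) + b)" for i
  have nz: "pochhammer (a + 1) i \<noteq> 0" "pochhammer (b + 1) i \<noteq> 0" for i
    by (rule pochhammer_nonzero[OF a], rule pochhammer_nonzero[OF b])
  have rec: "c (Suc i) * p (Suc i) = c i * q i" if i: "i < n" for i
  proof -
    obtain m where m: "n - i = Suc m" "n - Suc i = m"
      using i by (metis Suc_diff_Suc)
    have "Suc i * (n choose Suc i) = (n - i) * (n choose i)"
      by (metis binomial_absorb_comp binomial_absorption mult.commute)
    then have ch: "of_nat (Suc i) * of_nat (n choose Suc i) = (of_nat (Suc m) * of_nat (n choose i) :: complex)"
      unfolding m of_nat_mult[symmetric] by (rule arg_cong)
    have "c (Suc i) * p (Suc i) = (of_nat (Suc i) * of_nat (n choose Suc i)) * (a + 1 + of_nat i)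
        / (pochhammer (a + 1) i * (a + 1 + of_nat i) * pochhammer (b + 1) m)"
      by (simp add: c_def p_def m pochhammer_Suc algebra_simps)
    also have "\<dots> = of_nat (Suc m) * of_nat (n choose i) / (pochhammer (a + 1) i * pochhammer (b + 1) m)"
      unfolding ch using a[of i] by simp
    also have "\<dots> = of_nat (Suc m) * of_nat (n choose i) * (b + 1 + of_nat m)
        / (pochhammer (a + 1) i * (pochhammer (b + 1) m * (b + 1 + of_nat m)))"
      using b[of m] by simp
    also have "\<dots> = c i * q i"
      by (simp add: c_def q_def m pochhammer_Suc algebra_simps)
    finally show ?thesis .
  qed
  have A: "(\<Sum>i\<le>n. smult (c i * p i) (u ^ (i - 1) * v ^ Suc (n - i)))
      = (\<Sum>i\<le>n. smult (c i * q i) (u ^ i * v ^ (n - i)))"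
  proof (cases n)
    case (Suc N)
    have "(\<Sum>i\<le>n. smult (c i * p i) (u ^ (i - 1) * v ^ Suc (n - i)))
        = (\<Sum>i\<le>N. smult (c (Suc i) * p (Suc i)) (u ^ i * v ^ Suc (N - i)))"
      unfolding Suc by (subst sum.atMost_Suc_shift) (simp add: p_def)
    also have "\<dots> = (\<Sum>i\<le>N. smult (c i * q i) (u ^ i * v ^ (n - i)))"
      by (intro sum.cong refl) (simp add: rec Suc Suc_diff_le)
    finally show ?thesis
      unfolding Suc by (simp add: q_def Suc)
  qed (simp add: p_def q_def)
  have B: "(\<Sum>i\<le>n. smult (c i * q i) (u ^ Suc i * v ^ (n - i - 1)))
      = (\<Sum>i\<le>n. smult (c i * p i) (u ^ i * v ^ (n - i)))"
  proof (cases n)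
    case (Suc N)
    have "(\<Sum>i\<le>n. smult (c i * p i) (u ^ i * v ^ (n - i)))
        = (\<Sum>i\<le>N. smult (c (Suc i) * p (Suc i)) (u ^ Suc i * v ^ (N - i)))"
      unfolding Suc by (subst sum.atMost_Suc_shift) (simp add: p_def)
    also have "\<dots> = (\<Sum>i\<le>N. smult (c i * q i) (u ^ Suc i * v ^ (n - i - 1)))"
      by (intro sum.cong refl) (simp add: rec Suc)
    finally show ?thesis
      unfolding Suc by (simp add: q_def Suc)
  qed (simp add: p_def q_def)
  have e: "- p i - q i - (2 * of_nat i * of_nat (n - i) + (b + 1) * of_nat i + (a + 1) * of_nat (n - i))
      = jacobi_eigenvalue a b n" if "i \<le> n" for i
    using that by (simp add: p_def q_def jacobi_eigenvalue_def of_nat_diff algebra_simps)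
  have "jacobi_op a b (jacobi_poly a b n) = (\<Sum>i\<le>n. smult (c i) (
      - smult (p i) (u ^ (i - 1) * v ^ Suc (n - i))
      - smult (q i) (u ^ Suc i * v ^ (n - i - 1))
      - smult (2 * of_nat i * of_nat (n - i) + (b + 1) * of_nat i + (a + 1) * of_nat (n - i)) (u ^ i * v ^ (n - i))))"
    unfolding jacobi_poly_def jacobi_op_sum jacobi_op_smult jacobi_op_homogeneous p_def q_def c_def u_def v_def ..
  also have "\<dots> = - (\<Sum>i\<le>n. smult (c i * p i) (u ^ (i - 1) * v ^ Suc (n - i)))
      - (\<Sum>i\<le>n. smult (c i * q i) (u ^ Suc i * v ^ (n - i - 1)))
      - (\<Sum>i\<le>n. smult (c i * (2 * of_nat i * of_nat (n - i) + (b + 1) * of_nat i + (a + 1) * of_nat (n - i))) (u ^ i * v ^ (n - i)))"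
    by (simp only: smult_diff_right smult_minus_right smult_smult sum_subtractf sum_negf)
  also have "\<dots> = (\<Sum>i\<le>n. smult (c i * (- p i - q i
      - (2 * of_nat i * of_nat (n - i) + (b + 1) * of_nat i + (a + 1) * of_nat (n - i)))) (u ^ i * v ^ (n - i)))"
    unfolding A B by (simp add: smult_diff_left right_diff_distrib sum_subtractf sum_negf)
  also have "\<dots> = (\<Sum>i\<le>n. smult (c i * jacobi_eigenvalue a b n) (u ^ i * v ^ (n - i)))"
    by (intro sum.cong refl) (simp only: e atMost_iff)
  also have "\<dots> = smult (jacobi_eigenvalue a b n) (jacobi_poly a b n)"
    unfolding jacobi_poly_def smult_sum_right by (simp add: c_def u_def v_def mult.commute)
  finally show ?thesis .
qed

lemma degree_jacobi_poly_le: "degree (jacobi_poly a b n) \<le> n"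
  unfolding jacobi_poly_def
proof (intro degree_sum_le)
  fix i assume "i \<in> {..n}"
  have "degree ([:-1/2, 1/2 :: complex:] ^ i * [:1/2, 1/2:] ^ (n - i)) \<le> 1 * i + 1 * (n - i)"
    by (intro order.trans[OF degree_mult_le] add_mono order.trans[OF degree_power_le] mult_mono) auto
  with \<open>i \<in> {..n}\<close>
  show "degree (smult (of_nat (n choose i) / (pochhammer (a + 1) i * pochhammer (b + 1) (n - i)))
     ([:-1/2, 1/2:] ^ i * [:1/2, 1/2:] ^ (n - i))) \<le> n"
    by (intro order.trans[OF degree_smult_le]) auto
qed auto

lemma coeff_jacobi_op: "coeff (jacobi_op a b u) n = jacobi_eigenvalue a b n * coeff u n
    + (b - a) * of_nat (Suc n) * coeff u (Suc n) + of_nat (Suc n) * of_nat (Suc (Suc n)) * coeff u (Suc (Suc n))"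
proof -
  have "coeff (jacobi_op a b u) n = coeff (pderiv (pderiv u)) n
      - (if n < 2 then 0 else coeff (pderiv (pderiv u)) (n - 2))
      + (b - a) * coeff (pderiv u) n - (a + b + 2) * (if n = 0 then 0 else coeff (pderiv u) (n - 1))"
    by (cases n rule: nat.exhaust; cases "n - 1")
      (auto simp: jacobi_op_def coeff_pCons algebra_simps split: nat.split)
  also have "\<dots> = jacobi_eigenvalue a b n * coeff u n
    + (b - a) * of_nat (Suc n) * coeff u (Suc n) + of_nat (Suc n) * of_nat (Suc (Suc n)) * coeff u (Suc (Suc n))"
  proof -
    consider "n = 0" | "n = 1" | m where "n = Suc (Suc m)" by (metis One_nat_def not0_implies_Suc)
    then show ?thesis
      by cases (simp_all add: coeff_pderiv jacobi_eigenvalue_def algebra_simps)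
  qed
  finally show ?thesis .
qed

text \<open>The eigenvalue of degree \<open>n\<close> is attained by no smaller degree, so the degree does not drop.\<close>

lemma degree_jacobi_poly:
  assumes a: "\<And>j. a + 1 + of_nat j \<noteq> 0" and b: "\<And>j. b + 1 + of_nat j \<noteq> 0"
    and inj: "\<And>m. m < n \<Longrightarrow> jacobi_eigenvalue a b m \<noteq> jacobi_eigenvalue a b n"
  shows "degree (jacobi_poly a b n) = n"
proof (rule ccontr)
  let ?p = "jacobi_poly a b n"
  assume "degree ?p \<noteq> n"
  then have d: "degree ?p < n" using degree_jacobi_poly_le[of a b n] by simp
  have "pochhammer (b + 1) n \<noteq> 0" by (rule pochhammer_nonzero[OF b])
  then have "?p \<noteq> 0" using poly_jacobi_poly_1[of a b n] by auto
  have "jacobi_eigenvalue a b n * lead_coeff ?p = jacobi_eigenvalue a b (degree ?p) * lead_coeff ?p"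
    using coeff_jacobi_op[of a b ?p "degree ?p"] unfolding jacobi_op_jacobi_poly[OF a b] by (simp add: coeff_eq_0)
  with inj[OF d] \<open>?p \<noteq> 0\<close> show False by (metis mult_cancel_right leading_coeff_0_iff)
qed

lemma pderiv_jacobi_op: "pderiv (jacobi_op a b u) = jacobi_op (a + 1) (b + 1) (pderiv u) - smult (a + b + 2) (pderiv u)"
proof (rule poly_ext)
  fix x
  have "pderiv [:1, 0, -1:] = [:0, -2 :: complex:]"
    and "pderiv [:b - a, - (a + b + 2):] = [:- (a + b + 2):]"
    by (simp_all add: pderiv_pCons)
  then have "poly (pderiv (jacobi_op a b u)) x =
      (1 - x * x) * poly (pderiv (pderiv (pderiv u))) x - 2 * x * poly (pderiv (pderiv u)) x
      + (b - a - x * (a + b + 2)) * poly (pderiv (pderiv u)) x - (a + b + 2) * poly (pderiv u) x"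
    unfolding jacobi_op_def pderiv_add pderiv_mult poly_add poly_mult by (simp add: algebra_simps)
  then show "poly (pderiv (jacobi_op a b u)) x
      = poly (jacobi_op (a + 1) (b + 1) (pderiv u) - smult (a + b + 2) (pderiv u)) x"
    by (simp add: jacobi_op_def algebra_simps)
qed

text \<open>Differentiation turns an eigenfunction of the Jacobi operator into one with shifted
  parameters.  Where the second order coefficient vanishes, the equation is a first order recursion
  between successive derivatives.\<close>

lemma higher_pderiv_jacobi_eigenfunction:
  assumes "jacobi_op a b u = smult \<mu> u"
  shows "jacobi_op (a + of_nat j) (b + of_nat j) ((pderiv ^^ j) u)
    = smult (\<mu> + of_nat j * (a + b + 1 + of_nat j)) ((pderiv ^^ j) u)"
proof (induction j)
  case (Suc j)
  have "jacobi_op (a + of_nat j + 1) (b + of_nat j + 1) (pderiv ((pderiv ^^ j) u))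
     = smult (\<mu> + of_nat j * (a + b + 1 + of_nat j) + (a + of_nat j + (b + of_nat j) + 2)) (pderiv ((pderiv ^^ j) u))"
    using pderiv_jacobi_op[of "a + of_nat j" "b + of_nat j" "(pderiv ^^ j) u"]
    unfolding Suc pderiv_smult by (simp only: eq_diff_eq smult_add_left)
  then show ?case
    by (simp add: algebra_simps)
qed (use assms in simp)

text \<open>At an endpoint the equation of the \<open>j\<close>-th derivative has no second order term, so it gives the next
  derivative as a linear function of the eigenvalue times the present one.\<close>

lemma higher_pderiv_at_endpoint:
  fixes \<mu> :: "nat \<Rightarrow> complex"
  assumes a: "\<And>j. a + 1 + of_nat j \<noteq> 0" and b: "\<And>j. b + 1 + of_nat j \<noteq> 0"
    and u: "\<And>n. jacobi_op a b (u n) = smult (\<mu> n) (u n)" and \<epsilon>: "\<epsilon> = 1 \<or> \<epsilon> = -1"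
  shows "\<exists>R. \<forall>n. poly ((pderiv ^^ j) (u n)) \<epsilon> = poly R (\<mu> n) * poly (u n) \<epsilon>"
proof (induction j)
  case 0
  show ?case by (intro exI[of _ 1]) simp
next
  case (Suc j)
  then obtain R where R: "\<And>n. poly ((pderiv ^^ j) (u n)) \<epsilon> = poly R (\<mu> n) * poly (u n) \<epsilon>" by blast
  define d where "d = (b + of_nat j + 1) * (1 - \<epsilon>) - (a + of_nat j + 1) * (1 + \<epsilon>)"
  have d: "d \<noteq> 0"
  proof -
    have "d = - 2 * (a + 1 + of_nat j) \<or> d = 2 * (b + 1 + of_nat j)"
      using \<epsilon> by (auto simp: d_def algebra_simps)
    then show ?thesis using a[of j] b[of j] by (metis mult_eq_0_iff neg_equal_0_iff_equal zero_neq_numeral)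
  qed
  define C where "C = of_nat j * (a + b + 1 + of_nat j)"
  have "poly ((pderiv ^^ Suc j) (u n)) \<epsilon> = poly (smult (1 / d) ([:C, 1:] * R)) (\<mu> n) * poly (u n) \<epsilon>" for n
  proof -
    have "poly (jacobi_op (a + of_nat j) (b + of_nat j) w) \<epsilon> = d * poly (pderiv w) \<epsilon>" for w
      using \<epsilon> by (auto simp: jacobi_op_def d_def algebra_simps)
    from this[of "(pderiv ^^ j) (u n)"] have "d * poly ((pderiv ^^ Suc j) (u n)) \<epsilon>
        = (\<mu> n + C) * poly ((pderiv ^^ j) (u n)) \<epsilon>"
      unfolding higher_pderiv_jacobi_eigenfunction[OF u] by (simp add: C_def)
    then show ?thesis
      using d by (simp add: R field_simps)
  qed
  then show ?case by blast
qed

section \<open>No operator intertwines Jacobi polynomials with shifted parameter\<close>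

text \<open>A polynomial in \<open>n (n + \<sigma>)\<close> has even degree in \<open>n\<close>; the linear factor makes the degree on the left
  odd.\<close>

lemma parity_in_eigenvalue:
  assumes "\<And>n::nat. poly R (- (of_nat n * (of_nat n + \<sigma>))) * (of_nat n + e)
    = poly S (- (of_nat n * (of_nat n + \<sigma>)))"
  shows "R = 0 \<and> S = (0 :: complex poly)"
proof -
  define h where "h = [:0, - \<sigma>, -1:]"
  have h: "degree h = 2" by (simp add: h_def)
  \<comment> \<open>two polynomials in \<open>n\<close> that agree at all natural numbers\<close>
  have "pcompose R h * [:e, 1:] = pcompose S h"
  proof (rule ccontr)
    let ?p = "pcompose R h * [:e, 1:] - pcompose S h"
    assume "pcompose R h * [:e, 1:] \<noteq> pcompose S h"
    then have "finite {x. poly ?p x = 0}"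
      by (intro poly_roots_finite) simp
    moreover have "range (of_nat :: nat \<Rightarrow> complex) \<subseteq> {x. poly ?p x = 0}"
    proof clarify
      fix n :: nat
      have h: "poly h (of_nat n) = - (of_nat n * (of_nat n + \<sigma>))"
        by (simp add: h_def algebra_simps)
      have "poly ?p x = poly R (poly h x) * (x + e) - poly S (poly h x)" for x
        by (simp add: poly_pcompose algebra_simps)
      then show "poly ?p (of_nat n) = 0"
        unfolding h by (simp add: h assms)
    qed
    moreover have "infinite (range (of_nat :: nat \<Rightarrow> complex))"
      by (simp add: finite_image_iff inj_on_def)
    ultimately show False using finite_subset by blast
  qed
  moreover have "R = 0" if "pcompose R h * [:e, 1:] = pcompose S h"
  proof (rule ccontr)
    assume "R \<noteq> 0"
    then have "pcompose R h \<noteq> 0" using h by (simp add: pcompose_eq_0_iff)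
    then have "degree (pcompose R h * [:e, 1:]) = degree R * 2 + 1"
      by (subst degree_mult_eq) (auto simp: degree_pcompose h)
    then show False
      unfolding that by (simp add: degree_pcompose h) presburger
  qed
  ultimately show ?thesis
    using h by (auto simp: pcompose_eq_0_iff)
qed

text \<open>A differential operator evaluated at an endpoint only sees derivatives there, hence a polynomial
  in the eigenvalue times the endpoint value.  At \<open>-1\<close> the two families have equal values; at \<open>1\<close> the quotient of
  their values is linear in \<open>n\<close> up to inversion.  Eliminating \<open>m n\<close> leaves an identity that is excluded by
  parity.\<close>

lemma no_intertwiner:
  fixes m :: "nat \<Rightarrow> complex" and g :: "'i \<Rightarrow> complex poly" and d :: "'i \<Rightarrow> nat"
  assumes a: "\<And>j. a + 1 + of_nat j \<noteq> 0" and b: "\<And>j. b + 1 + of_nat j \<noteq> 0"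
    and b': "b' = b + 1 \<or> b = b' + 1" "\<And>j. b' + 1 + of_nat j \<noteq> 0"
    and eq: "\<And>n. (\<Sum>i\<in>I. (pderiv ^^ d i) (jacobi_poly a b n) * g i) = smult (m n) (jacobi_poly a b' n)"
  shows "m n = 0"
proof -
  let ?\<mu> = "jacobi_eigenvalue a b"
  have nz: "pochhammer (a + 1) i \<noteq> 0" "pochhammer (b + 1) i \<noteq> 0" "pochhammer (b' + 1) i \<noteq> 0" for i
    by (rule pochhammer_nonzero[OF a], rule pochhammer_nonzero[OF b], rule pochhammer_nonzero[OF b'(2)])
  have "\<exists>R. \<forall>n. m n * poly (jacobi_poly a b' n) \<epsilon> = poly R (?\<mu> n) * poly (jacobi_poly a b n) \<epsilon>"
    if \<epsilon>: "\<epsilon> = 1 \<or> \<epsilon> = -1" for \<epsilon>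
  proof -
    have "\<exists>R. \<forall>n. poly ((pderiv ^^ j) (jacobi_poly a b n)) \<epsilon> = poly R (?\<mu> n) * poly (jacobi_poly a b n) \<epsilon>" for j
      by (rule higher_pderiv_at_endpoint[OF a b jacobi_op_jacobi_poly[OF a b] \<epsilon>])
    then obtain R where R: "\<And>j n. poly ((pderiv ^^ j) (jacobi_poly a b n)) \<epsilon>
        = poly (R j) (?\<mu> n) * poly (jacobi_poly a b n) \<epsilon>" by metis
    have "m n * poly (jacobi_poly a b' n) \<epsilon>
        = poly (\<Sum>i\<in>I. smult (poly (g i) \<epsilon>) (R (d i))) (?\<mu> n) * poly (jacobi_poly a b n) \<epsilon>" for n
      using arg_cong[OF eq[of n], of "\<lambda>p. poly p \<epsilon>"]
      by (simp add: poly_sum R sum_distrib_left sum_distrib_right mult_ac)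
    then show ?thesis by blast
  qed
  from this[of "-1"] this[of 1] obtain R S
    where "\<And>n. m n * poly (jacobi_poly a b' n) (-1) = poly R (?\<mu> n) * poly (jacobi_poly a b n) (-1)"
      and S: "\<And>n. m n * poly (jacobi_poly a b' n) 1 = poly S (?\<mu> n) * poly (jacobi_poly a b n) 1"
    by blast
  then have R: "m n = poly R (?\<mu> n)" for n
    using nz by (simp add: poly_jacobi_poly_minus_1)
  have S: "m n * pochhammer (b + 1) n = poly S (?\<mu> n) * pochhammer (b' + 1) n" for n
    using S[of n] nz by (simp add: poly_jacobi_poly_1 field_simps)
  have shift: "pochhammer (z + 1) n * z = (z + of_nat n) * pochhammer z n" for z :: complex and n
    using pochhammer_rec[of z n] pochhammer_rec'[of z n] by (simp add: mult.commute)
  from b'(1) have "R = 0"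
  proof
    assume bb: "b' = b + 1"
    have "poly S (?\<mu> n) * (of_nat n + (b + 1)) = poly (smult (b + 1) R) (?\<mu> n)" for n
    proof -
      have "pochhammer (b + 1) n * (poly S (?\<mu> n) * (of_nat n + (b + 1)))
          = poly S (?\<mu> n) * (pochhammer (b' + 1) n * (b + 1))"
        unfolding bb shift by (simp add: algebra_simps)
      also have "\<dots> = pochhammer (b + 1) n * poly (smult (b + 1) R) (?\<mu> n)"
        using S[of n] by (simp add: R mult.commute)
      finally show ?thesis using nz(2)[of n] by (simp only: mult_cancel_left simp_thms)
    qed
    then have "smult (b + 1) R = 0"
      using parity_in_eigenvalue[of S "a + b + 1" "b + 1" "smult (b + 1) R"]
      by (simp add: jacobi_eigenvalue_def add.assoc)
    then show "R = 0" using b[of 0] by simp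
  next
    assume bb: "b = b' + 1"
    have "poly R (?\<mu> n) * (of_nat n + (b' + 1)) = poly (smult (b' + 1) S) (?\<mu> n)" for n
    proof -
      have "pochhammer (b' + 1) n * (poly R (?\<mu> n) * (of_nat n + (b' + 1)))
          = m n * (pochhammer (b + 1) n * (b' + 1))"
        unfolding bb shift by (simp add: R bb algebra_simps)
      also have "\<dots> = pochhammer (b' + 1) n * poly (smult (b' + 1) S) (?\<mu> n)"
        using S[of n] by simp
      finally show ?thesis using nz(3)[of n] by (simp only: mult_cancel_left simp_thms)
    qed
    then show "R = 0"
      using parity_in_eigenvalue[of R "a + b + 1" "b' + 1" "smult (b' + 1) S"]
      by (simp add: jacobi_eigenvalue_def add.assoc)
  qed
  then show ?thesis by (simp add: R)
qed

section \<open>The Jacobi functional and the inner product\<close>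

locale jacobi_weight =
  fixes \<alpha> \<beta> k :: real
  assumes \<alpha>: "\<alpha> > -1" and \<beta>: "\<beta> > -1" and k: "0 < k" "k < \<alpha> + 1"
begin

text \<open>The parameters \<open>\<alpha> + 1\<close>, \<open>\<beta> + 1\<close> and \<open>k\<close> as opaque complex constants, and \<open>1 - x\<close> and \<open>1 + x\<close> as opaque
  polynomials: algebraic identities between operators are then checked by plain ring normalization.\<close>

definition aa :: complex where "aa = of_real (\<alpha> + 1)"
definition bb :: complex where "bb = of_real (\<beta> + 1)"
definition kk :: complex where "kk = of_real k"

definition Y :: "complex poly" where "Y = [:1, -1:]"
definition Z :: "complex poly" where "Z = [:1, 1:]"

lemma pderiv_YZ [simp]: "pderiv Y = -1" "pderiv Z = 1"
  by (simp_all add: Y_def Z_def pderiv_pCons one_pCons)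

lemma poly_YZ [simp]: "poly Y x = 1 - x" "poly Z x = 1 + x"
  by (simp_all add: Y_def Z_def)

lemma coeff_Y_mult: "coeff (Y * p) m = coeff p m - (if m = 0 then 0 else coeff p (m - 1))"
  by (cases m) (auto simp: Y_def)

lemma coeff_Z_mult: "coeff (Z * p) m = coeff p m + (if m = 0 then 0 else coeff p (m - 1))"
  by (cases m) (auto simp: Z_def)

abbreviation I :: "real set" where "I \<equiv> {-1<..<1}"

definition w :: "real \<Rightarrow> real" where "w x = (1 - x) powr \<alpha> * (1 + x) powr \<beta>"

definition J :: "complex poly \<Rightarrow> complex" where
  "J u = (LINT x:I|lborel. w x *\<^sub>R poly u (of_real x))"

lemma integrable_w_poly:
  fixes u :: "complex poly"
  shows "set_integrable lborel I (\<lambda>x. w x *\<^sub>R poly u (of_real x))"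
proof -
  have "set_integrable lborel I (\<lambda>x. (w x * x ^ i) *\<^sub>R c)" for i and c :: complex
    using integrable_jacobi_scalar[OF \<alpha> \<beta>, of i] by (simp add: w_def)
  then have "set_integrable lborel I (\<lambda>x. \<Sum>i\<le>degree u. (w x * x ^ i) *\<^sub>R coeff u i)"
    unfolding set_integrable_def scaleR_sum_right by (intro Bochner_Integration.integrable_sum) auto
  moreover have "(\<Sum>i\<le>degree u. (w x * x ^ i) *\<^sub>R coeff u i) = w x *\<^sub>R poly u (of_real x)" for x
    by (simp add: poly_altdef scaleR_conv_of_real sum_distrib_left mult_ac)
  ultimately show ?thesis by simp
qed

lemma J_add: "J (u + v) = J u + J v"
  unfolding J_def poly_add scaleR_add_right by (rule set_integral_add) (rule integrable_w_poly)+

lemma J_smult: "J (smult c u) = c * J u"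
proof -
  have "w x *\<^sub>R poly (smult c u) (of_real x) = c * (w x *\<^sub>R poly u (of_real x))" for x
    by simp
  then show ?thesis unfolding J_def by (simp only: set_integral_mult_right)
qed

lemma J_diff: "J (u - v) = J u - J v"
  using J_add[of u "smult (-1) v"] J_smult[of "-1" v] by simp

lemma J_cnj: "J (map_poly cnj u) = cnj (J u)"
proof -
  have "w x *\<^sub>R cnj z = cnj (w x *\<^sub>R z)" "indicat_real A x *\<^sub>R cnj z = cnj (indicat_real A x *\<^sub>R z)" for x z A
    by simp_all
  then show ?thesis
    unfolding J_def set_lebesgue_integral_def by (simp only: poly_map_poly_cnj complex_cnj_complex_of_real
        Bochner_Integration.integral_cnj)
qed

lemma J_0 [simp]: "J 0 = 0"
  by (simp add: J_def)

text \<open>The fundamental theorem of calculus for \<open>(1 - x)\<^bsup>\<alpha>+1\<^esup> (1 + x)\<^bsup>\<beta>+1\<^esup> u\<close>, which vanishes at both ends.\<close>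

lemma J_derivative: "J (Y * Z * pderiv u + (smult bb Y - smult aa Z) * u) = 0"
proof -
  let ?v = "Y * Z * pderiv u + (smult bb Y - smult aa Z) * u"
  define F where "F x = ((1 - x) powr (\<alpha> + 1) * (1 + x) powr (\<beta> + 1)) *\<^sub>R poly u (of_real x)" for x
  have "((\<lambda>x. w x *\<^sub>R poly ?v (of_real x)) has_integral (F 1 - F (-1))) {-1..1}"
  proof (rule fundamental_theorem_of_calculus_interior)
    show "continuous_on {-1..1} F"
      unfolding F_def using \<alpha> \<beta> by (intro continuous_intros continuous_on_powr') auto
    show "(F has_vector_derivative w x *\<^sub>R poly ?v (of_real x)) (at x)" if x: "x \<in> {-1<..<1}" for x
    proof -
      have "((\<lambda>x. (1 - x) powr (\<alpha> + 1) * (1 + x) powr (\<beta> + 1)) has_real_derivative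
          w x * ((\<beta> + 1) * (1 - x) - (\<alpha> + 1) * (1 + x))) (at x)"
      proof -
        define a b where "a = (1 - x) powr \<alpha>" and "b = (1 + x) powr \<beta>"
        have der: "((\<lambda>x. (1 - x) powr (\<alpha> + 1) * (1 + x) powr (\<beta> + 1)) has_real_derivative
          - ((\<alpha> + 1) * (1 - x) powr \<alpha>) * (1 + x) powr (\<beta> + 1)
          + (\<beta> + 1) * (1 + x) powr \<beta> * (1 - x) powr (\<alpha> + 1)) (at x)"
          using x by (intro DERIV_mult) (auto intro!: derivative_eq_intros)
        have pw: "(1 - x) powr (\<alpha> + 1) = a * (1 - x)" "(1 + x) powr (\<beta> + 1) = b * (1 + x)"
          using x by (simp_all add: powr_add a_def b_def)
        have "- ((\<alpha> + 1) * (1 - x) powr \<alpha>) * (1 + x) powr (\<beta> + 1)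
            + (\<beta> + 1) * (1 + x) powr \<beta> * (1 - x) powr (\<alpha> + 1)
            = w x * ((\<beta> + 1) * (1 - x) - (\<alpha> + 1) * (1 + x))"
          unfolding pw w_def a_def[symmetric] b_def[symmetric] by (simp add: algebra_simps)
        with der show ?thesis by (simp only:)
      qed
      moreover have "((\<lambda>x. poly u (of_real x)) has_vector_derivative poly (pderiv u) (of_real x)) (at x)"
        by (rule has_vector_derivative_real_field poly_DERIV)+
      ultimately have der: "(F has_vector_derivative
          ((1 - x) powr (\<alpha> + 1) * (1 + x) powr (\<beta> + 1)) *\<^sub>R poly (pderiv u) (of_real x)
          + (w x * ((\<beta> + 1) * (1 - x) - (\<alpha> + 1) * (1 + x))) *\<^sub>R poly u (of_real x)) (at x)"
        unfolding F_def by (rule has_vector_derivative_scaleR)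
      have pw: "(1 - x) powr (\<alpha> + 1) * (1 + x) powr (\<beta> + 1) = w x * ((1 - x) * (1 + x))"
        using x by (simp add: w_def powr_add)
      have "(w x * ((1 - x) * (1 + x))) *\<^sub>R poly (pderiv u) (of_real x)
          + (w x * ((\<beta> + 1) * (1 - x) - (\<alpha> + 1) * (1 + x))) *\<^sub>R poly u (of_real x)
          = w x *\<^sub>R poly ?v (of_real x)"
        by (simp add: aa_def bb_def scaleR_conv_of_real algebra_simps)
      with der show ?thesis
        unfolding pw by (simp only:)
    qed
  qed simp
  moreover have "F 1 = 0" "F (-1) = 0"
    by (simp_all add: F_def)
  ultimately have "((\<lambda>x. w x *\<^sub>R poly ?v (of_real x)) has_integral 0) I"
    by (simp add: has_integral_Icc_iff_Ioo)
  then show ?thesis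
    unfolding J_def set_borel_integral_eq_integral(2)[OF integrable_w_poly] by (rule integral_unique)
qed

text \<open>Integration by parts, with the boundary term \<open>U\<close> as a witness.\<close>

lemma J_eqI:
  assumes "u - v = Y * Z * pderiv U + (smult bb Y - smult aa Z) * U"
  shows "J u = J v"
  using J_derivative[of U] unfolding assms[symmetric] J_diff by simp

text \<open>The weight without its scalar factor \<open>w\<close>, as a bilinear form on rows; conjugation is kept apart so
  that integration by parts concerns bilinear expressions only.\<close>

definition wform :: "complex poly ^ 2 \<Rightarrow> complex poly ^ 2 \<Rightarrow> complex poly" where
  "wform p q = (smult (4 * aa) 1 - smult (2 * kk) Y) * p $ 1 * q $ 1
     + smult (2 * (aa - kk)) Y * (p $ 1 * q $ 2 + p $ 2 * q $ 1)
     + smult (aa - kk) (Y * Y) * p $ 2 * q $ 2"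

definition conj_row :: "complex poly ^ 2 \<Rightarrow> complex poly ^ 2" where
  "conj_row p = (\<chi> i. map_poly cnj (p $ i))"

abbreviation "inner_prod \<equiv> inner_W I (jacobi_W \<alpha> \<beta> k)"

lemma inner_integrand:
  "(mpeval P x ** jacobi_W \<alpha> \<beta> k x ** ctranspose (mpeval Q x)) $ i $ j
    = w x *\<^sub>R poly (wform (P $ i) (conj_row (Q $ j))) (of_real x)"
  unfolding jacobi_W_def w_def[symmetric]
  by (simp add: matrix_matrix_mult_def sum_2 mpeval_def ctranspose_def wform_def conj_row_def
      aa_def kk_def power2_eq_square) (simp add: scaleR_conv_of_real algebra_simps)

lemma inner_entry: "inner_prod P Q $ i $ j = J (wform (P $ i) (conj_row (Q $ j)))"
  by (simp add: inner_W_def inner_integrand J_def)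

lemma wform_commute: "wform p q = wform q p"
  by (simp add: wform_def algebra_simps)

lemma map_poly_cnj_arith:
  "map_poly cnj (p + q) = map_poly cnj p + map_poly cnj q"
  "map_poly cnj (p - q) = map_poly cnj p - map_poly cnj q"
  "map_poly cnj (p * q) = map_poly cnj p * map_poly cnj q"
  "map_poly cnj (smult c p) = smult (cnj c) (map_poly cnj p)"
  "map_poly cnj (pderiv p) = pderiv (map_poly cnj p)"
  by (auto intro!: poly_ext[of "map_poly cnj _"] simp: poly_eq_iff[of "map_poly cnj (pderiv p)"]
      coeff_map_poly coeff_pderiv)

lemma map_poly_cnj_YZ [simp]: "map_poly cnj Y = Y" "map_poly cnj Z = Z"
  by (rule poly_ext, simp)+

lemma cnj_abk [simp]: "cnj aa = aa" "cnj bb = bb" "cnj kk = kk"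
  by (simp_all add: aa_def bb_def kk_def)

lemma conj_row_wform: "map_poly cnj (wform p q) = wform (conj_row p) (conj_row q)"
  by (rule poly_ext) (simp add: wform_def conj_row_def)

lemma conj_row_conj_row [simp]: "conj_row (conj_row p) = p"
  by (simp add: conj_row_def vec_eq_iff poly_eq_iff coeff_map_poly)

lemma inner_hermitian: "inner_prod Q P = ctranspose (inner_prod P Q)"
  by (simp add: vec_eq_iff ctranspose_def inner_entry wform_commute[of _ "conj_row (P $ _)"]
      flip: J_cnj) (simp add: conj_row_wform)

lemma inner_eq_0_commute: "inner_prod Q P = 0 \<longleftrightarrow> inner_prod P Q = 0"
  by (subst inner_hermitian) (auto simp: ctranspose_def vec_eq_iff)

lemma inner_add_left: "inner_prod (P + P') Q = inner_prod P Q + inner_prod P' Q"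
proof -
  have "wform (p + p') q = wform p q + wform p' q" for p p' q
    by (rule poly_ext) (simp add: wform_def algebra_simps)
  then show ?thesis by (simp add: vec_eq_iff inner_entry J_add)
qed

lemma inner_mpconst_mult: "inner_prod (mpconst A ** P) Q = A ** inner_prod P Q"
proof -
  have "wform ((mpconst A ** P) $ i) q = smult (A $ i $ 1) (wform (P $ 1) q) + smult (A $ i $ 2) (wform (P $ 2) q)" for i q
    by (rule poly_ext) (simp add: wform_def matrix_matrix_mult_def mpconst_def sum_2 algebra_simps)
  then show ?thesis
    by (simp add: vec_eq_iff inner_entry J_add J_smult matrix_matrix_mult_def sum_2)
qed

lemma inner_0_left [simp]: "inner_prod 0 Q = 0"
  by (simp add: vec_eq_iff inner_entry wform_def)

lemma inner_diff_left: "inner_prod (P - P') Q = inner_prod P Q - inner_prod P' Q"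
  using inner_add_left[of "P - P'" P' Q] by simp

lemma poly_eq_0_if_AE_0:
  fixes p :: "complex poly"
  assumes "AE x in lborel. x \<in> I \<longrightarrow> poly p (of_real x) = 0"
  shows "p = 0"
proof (rule ccontr)
  assume "p \<noteq> 0"
  then have "finite {z. poly p z = 0}" by (rule poly_roots_finite)
  then have "finite (of_real -` {z. poly p z = 0} :: real set)"
    by (rule finite_vimageI) (simp add: inj_def)
  then have "{x. poly p (of_real x) = 0} \<in> null_sets (lborel :: real measure)"
    by (simp add: vimage_def finite_imp_null_set_lborel)
  then have "AE x in lborel. poly p (of_real x) \<noteq> 0"
    by (rule AE_not_in[THEN eventually_mono]) simp
  with assms have "AE x::real in lborel. x \<notin> I" by eventually_elim auto
  then have "emeasure lborel {x::real. x \<in> I} = 0"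
    by (subst (asm) AE_iff_measurable[OF _ refl]) auto
  moreover have "{x::real. x \<in> I} = I" by blast
  ultimately have "emeasure lborel I = 0" by (simp only:)
  then show False by simp
qed

text \<open>The diagonal entries integrate a pointwise nonnegative form that is definite almost everywhere, so
  each row vanishes almost everywhere, hence identically.\<close>

lemma inner_definite:
  assumes "inner_prod P P = 0"
  shows "P = 0"
proof -
  let ?W = "jacobi_W \<alpha> \<beta> k"
  have pd: "AE x in lborel. x \<in> I \<longrightarrow> pos_def (?W x)"
    using weight_matrix_jacobi_W[OF \<alpha> \<beta> k] by (simp add: weight_matrix_def)
  have "P $ i $ j = 0" for i j
  proof (rule poly_eq_0_if_AE_0)
    define u where "u = wform (P $ i) (conj_row (P $ i))"
    define f where "f x = Re (indicat_real I x *\<^sub>R (w x *\<^sub>R poly u (of_real x)))" for x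
    have form: "w x *\<^sub>R poly u (of_real x) = (\<Sum>a\<in>UNIV. \<Sum>b\<in>UNIV.
        mpeval P x $ i $ a * ?W x $ a $ b * cnj (mpeval P x $ i $ b))" for x
      unfolding u_def inner_integrand[symmetric]
      by (simp add: matrix_matrix_mult_def ctranspose_def sum_2 algebra_simps)
    have "integral\<^sup>L lborel f = Re (J u)"
      unfolding f_def J_def set_lebesgue_integral_def
      by (rule integral_Re) (use integrable_w_poly[of u] in \<open>simp add: set_integrable_def\<close>)
    also have "J u = 0"
      using assms inner_entry[of P P i i] by (simp add: u_def)
    finally have "integral\<^sup>L lborel f = 0" by simp
    moreover have "integrable lborel f"
      unfolding f_def
      by (rule integrable_Re) (use integrable_w_poly[of u] in \<open>simp add: set_integrable_def\<close>)
    moreover have "AE x in lborel. 0 \<le> f x"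
      using pd
    proof eventually_elim
      case (elim x)
      have "0 \<le> Re (w x *\<^sub>R poly u (of_real x))" if "x \<in> I"
        unfolding form using elim that unfolding pos_def_def
        by (cases "mpeval P x $ i = 0") (auto intro: less_imp_le)
      then show ?case
        by (auto simp: f_def indicator_def)
    qed
    ultimately have "AE x in lborel. f x = 0"
      by (simp add: integral_nonneg_eq_0_iff_AE)
    with pd show "AE x in lborel. x \<in> I \<longrightarrow> poly (P $ i $ j) (of_real x) = 0"
    proof eventually_elim
      case (elim x)
      show ?case
      proof
        assume x: "x \<in> I"
        with elim(2) have "Re (w x *\<^sub>R poly u (of_real x)) = 0" by (simp add: f_def)
        with elim(1) x have "mpeval P x $ i = 0"
          unfolding form pos_def_def by force
        then have "mpeval P x $ i $ j = 0" by simp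
        then show "poly (P $ i $ j) (of_real x) = 0" by (simp add: mpeval_def)
      qed
    qed
  qed
  then show ?thesis by (simp add: vec_eq_iff)
qed

lemma monic_ops_orthogonal_lower:
  assumes "is_monic_ops I (jacobi_W \<alpha> \<beta> k) P" "mdeg_less n Q"
  shows "inner_prod (P n) Q = 0"
proof -
  have "inner_prod Q (P n) = 0"
  proof (rule mpoly_basis_induct[of n P "\<lambda>Q. inner_prod Q (P n) = 0"])
    show "mdeg_less (Suc m) (P m)" for m
      using assms(1) by (auto simp: is_monic_ops_def mdeg_less_def)
    show "\<exists>L. L ** mpcoeff (P m) m = mat 1" for m
      using assms(1) by (intro exI[of _ "mat 1"]) (simp add: is_monic_ops_def)
    show "inner_prod (mpconst A ** P m + Q') (P n) = 0" if "m < n" "inner_prod Q' (P n) = 0" for m A Q'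
      using that assms(1) by (simp add: inner_add_left inner_mpconst_mult is_monic_ops_def)
  qed (use assms in auto)
  then show ?thesis by (subst inner_eq_0_commute)
qed

text \<open>Two monic sequences differ in each degree by a polynomial of lower degree, which is orthogonal
  to itself.\<close>

lemma monic_ops_eqI:
  assumes P: "is_monic_ops I (jacobi_W \<alpha> \<beta> k) P"
  shows "monic_ops I (jacobi_W \<alpha> \<beta> k) = P"
  unfolding monic_ops_def
proof (rule the_equality[where P = "is_monic_ops I (jacobi_W \<alpha> \<beta> k)", OF P])
  fix P' assume P': "is_monic_ops I (jacobi_W \<alpha> \<beta> k) P'"
  show "P' = P"
  proof
    fix n
    have "mpcoeff (P' n - P n) m = 0" if "m \<ge> n" for m
      using P P' that by (cases "m = n") (auto simp: is_monic_ops_def mpcoeff_diff)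
    then have "mdeg_less n (P' n - P n)"
      by (simp add: mdeg_less_def)
    then have "inner_prod (P' n - P n) (P' n - P n) = 0"
      using monic_ops_orthogonal_lower[OF P] monic_ops_orthogonal_lower[OF P'] by (simp add: inner_diff_left)
    then show "P' n = P n" using inner_definite by force
  qed
qed

section \<open>The Darboux factorization\<close>

text \<open>In the coordinates \<open>f = 2 p\<^sub>1 + (1 - x) p\<^sub>2\<close> and \<open>g = p\<^sub>1\<close>, a pair \<open>(r, 0)\<close> goes to
  \<open>f = (1 - x\<^sup>2) r' + (\<beta> - \<alpha> - (\<alpha> + \<beta> + 2) x + k (1 + x)) r\<close> and \<open>g = -(\<alpha> + 1 - k) r\<close>, and a pair \<open>(0, q)\<close> to
  \<open>f = 2 k q\<close> and \<open>g = k q - (1 - x) q'\<close>.  The coefficients make \<open>f(1) = 2 g(1)\<close>, and they make the images of the Jacobi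
  polynomials of positive degree orthogonal to the constant row \<open>(1, 0)\<close>, where \<open>f = 2\<close> and \<open>g = 1\<close>.\<close>

definition row_A :: "complex poly ^ 2 \<Rightarrow> complex poly ^ 2" where
  "row_A p = vector [
     smult kk (p $ 2) - smult (aa - kk) (p $ 1) - Y * pderiv (p $ 2),
     Z * pderiv (p $ 1) + smult (aa + bb - kk) (p $ 1) + smult 2 (pderiv (p $ 2))]"

definition row_B :: "complex poly ^ 2 \<Rightarrow> complex poly ^ 2" where
  "row_B p = vector [
     smult (kk + 1) (p $ 2) - smult 2 (pderiv (p $ 1)) - Y * pderiv (p $ 2),
     Z * pderiv (p $ 1) + smult (aa + bb - kk) (p $ 1) + smult (aa - kk) (p $ 2)]"

definition dA :: "2 diffop" where
  "dA = Poly_Mapping.single 0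
      (vector [vector [[:kk - aa:], [:aa + bb - kk:]], vector [[:kk:], 0]])
    + Poly_Mapping.single 1 (vector [vector [0, Z], vector [- Y, [:2:]]])"

definition dB :: "2 diffop" where
  "dB = Poly_Mapping.single 0
      (vector [vector [0, [:aa + bb - kk:]], vector [[:kk + 1:], [:aa - kk:]]])
    + Poly_Mapping.single 1 (vector [vector [[:-2:], Z], vector [- Y, 0]])"

definition dE :: "2 \<Rightarrow> 2 diffop" where
  "dE i = Poly_Mapping.single 0 (\<chi> a b. if a = i \<and> b = i then 1 else 0)"

lemma dA_act: "(P \<lhd> dA) $ i = row_A (P $ i)"
  by (simp add: dA_def dop_act_add dop_act_single vec_eq_iff forall_2 row_A_def
      matrix_matrix_mult_def mpderiv_def sum_2 smult_diff_left algebra_simps)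

lemma dB_act: "(P \<lhd> dB) $ i = row_B (P $ i)"
  by (simp add: dB_def dop_act_add dop_act_single vec_eq_iff forall_2 row_B_def
      matrix_matrix_mult_def mpderiv_def sum_2 algebra_simps)

lemma dE_act: "(P \<lhd> dE i) $ a $ b = (if b = i then P $ a $ i else 0)"
  by (simp add: dE_def dop_act_single matrix_matrix_mult_def if_distrib[of "\<lambda>u. _ * u"] cong: if_cong)

text \<open>\<open>row_B\<close> is the adjoint of \<open>row_A\<close> from a direct sum of two scalar Jacobi weights, up to the
  positive constants \<open>\<alpha> + 1 - k\<close> and \<open>2 k\<close>.\<close>

lemma J_wform_row_A:
  "J (wform (row_A p) q) = J (smult (aa - kk) (Y * Z * p $ 1 * row_B q $ 1) + smult (2 * kk) (Y * p $ 2 * row_B q $ 2))"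
proof (rule J_eqI)
  \<comment> \<open>the boundary terms left by the derivatives of \<open>p $ 1\<close> and \<open>p $ 2\<close> in \<open>row_A p\<close>\<close>
  define U where "U = smult (aa - kk) (p $ 1 * (smult 2 (q $ 1) + Y * q $ 2)) - smult (2 * kk) (p $ 2 * q $ 1)"
  show "wform (row_A p) q - (smult (aa - kk) (Y * Z * p $ 1 * row_B q $ 1) + smult (2 * kk) (Y * p $ 2 * row_B q $ 2))
      = Y * Z * pderiv U + (smult bb Y - smult aa Z) * U"
    by (rule poly_ext)
      (simp add: U_def wform_def row_A_def row_B_def pderiv_mult pderiv_add pderiv_diff pderiv_smult algebra_simps)
qed

lemma jacobi_op_YZ: "jacobi_op (aa + c) (bb + d) u = Y * Z * pderiv (pderiv u)
    + (smult (bb + d + 1) Y - smult (aa + c + 1) Z) * pderiv u"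
  by (rule poly_ext) (simp add: jacobi_op_def Y_def Z_def algebra_simps)

text \<open>The off-diagonal entries cancel: this is the orthogonality of the ranges of the two columns of the
  factorization.\<close>

lemma row_B_row_A:
  "row_B (row_A p) = vector [
     smult ((kk + 1) * (aa + bb - kk)) (p $ 1) - jacobi_op aa bb (p $ 1),
     smult (kk * (aa + bb - kk)) (p $ 2) - jacobi_op aa (bb - 1) (p $ 2)]"
  using jacobi_op_YZ[of 0 0] jacobi_op_YZ[of 0 "-1"]
  by (simp add: vec_eq_iff forall_2)
    (intro conjI poly_ext; simp add: row_A_def row_B_def pderiv_mult pderiv_add pderiv_diff pderiv_smult algebra_simps)

text \<open>Multiplication by \<open>Y * Z\<close> and \<open>Y\<close> turns \<open>w\<close> into the Jacobi weights for the parameters \<open>(\<alpha> + 1, \<beta> + 1)\<close> and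
  \<open>(\<alpha> + 1, \<beta>)\<close>; the boundary term is a multiple of the Wronskian.\<close>

lemma J_jacobi_op_selfadjoint:
  "J (Y * Z * jacobi_op aa bb u * v) = J (Y * Z * u * jacobi_op aa bb v)"
  "J (Y * jacobi_op aa (bb - 1) u * v) = J (Y * u * jacobi_op aa (bb - 1) v)"
proof -
  let ?w = "pderiv u * v - u * pderiv v"
  show "J (Y * Z * jacobi_op aa bb u * v) = J (Y * Z * u * jacobi_op aa bb v)"
    by (rule J_eqI[of _ _ "Y * Z * ?w"], rule poly_ext)
      (simp add: jacobi_op_YZ[of 0 0, simplified] pderiv_mult pderiv_diff algebra_simps)
  show "J (Y * jacobi_op aa (bb - 1) u * v) = J (Y * u * jacobi_op aa (bb - 1) v)"
    by (rule J_eqI[of _ _ "Y * ?w"], rule poly_ext)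
      (simp add: jacobi_op_YZ[of 0 "-1", simplified] pderiv_mult pderiv_diff algebra_simps)
qed

definition rP :: "nat \<Rightarrow> complex poly" where "rP = jacobi_poly aa bb"
definition qP :: "nat \<Rightarrow> complex poly" where "qP = jacobi_poly aa (bb - 1)"

lemma ab_nonzero:
  "aa + 1 + of_nat j \<noteq> 0" "bb + 1 + of_nat j \<noteq> 0" "bb - 1 + 1 + of_nat j \<noteq> 0"
proof -
  have "aa + 1 + of_nat j = of_real (\<alpha> + 2 + real j)" "bb + 1 + of_nat j = of_real (\<beta> + 2 + real j)"
    "bb - 1 + 1 + of_nat j = of_real (\<beta> + 1 + real j)"
    by (simp_all add: aa_def bb_def)
  moreover have "\<alpha> + 2 + real j > 0" "\<beta> + 2 + real j > 0" "\<beta> + 1 + real j > 0"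
    using \<alpha> \<beta> by auto
  ultimately show "aa + 1 + of_nat j \<noteq> 0" "bb + 1 + of_nat j \<noteq> 0" "bb - 1 + 1 + of_nat j \<noteq> 0"
    by (metis of_real_eq_0_iff less_irrefl)+
qed

text \<open>Both eigenvalues have the form \<open>-n (n + c)\<close> with \<open>c > 0\<close>, which is strictly decreasing in \<open>n\<close>.\<close>

lemma jacobi_eigenvalue_inj:
  assumes "m < n"
  shows "jacobi_eigenvalue aa bb m \<noteq> jacobi_eigenvalue aa bb n" "jacobi_eigenvalue aa (bb - 1) m \<noteq> jacobi_eigenvalue aa (bb - 1) n"
proof -
  have *: "real m * (real m + c) < real n * (real n + c)" if "c > 0" for c
    using assms that by (intro mult_strict_mono') auto
  have pos: "\<alpha> + \<beta> + 3 > 0" "\<alpha> + \<beta> + 2 > 0" using \<alpha> \<beta> by auto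
  have eig: "jacobi_eigenvalue aa bb i = of_real (- (real i * (real i + (\<alpha> + \<beta> + 3))))"
    "jacobi_eigenvalue aa (bb - 1) i = of_real (- (real i * (real i + (\<alpha> + \<beta> + 2))))" for i
    by (simp_all add: jacobi_eigenvalue_def aa_def bb_def algebra_simps)
  show "jacobi_eigenvalue aa bb m \<noteq> jacobi_eigenvalue aa bb n"
    unfolding eig of_real_eq_iff using *[OF pos(1)] by simp
  show "jacobi_eigenvalue aa (bb - 1) m \<noteq> jacobi_eigenvalue aa (bb - 1) n"
    unfolding eig of_real_eq_iff using *[OF pos(2)] by simp
qed

lemma jacobi_op_rP: "jacobi_op aa bb (rP n) = smult (jacobi_eigenvalue aa bb n) (rP n)"
  unfolding rP_def by (rule jacobi_op_jacobi_poly) (rule ab_nonzero)+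

lemma jacobi_op_qP: "jacobi_op aa (bb - 1) (qP n) = smult (jacobi_eigenvalue aa (bb - 1) n) (qP n)"
  unfolding qP_def by (rule jacobi_op_jacobi_poly) (rule ab_nonzero)+

lemma degree_rP: "degree (rP n) = n"
  unfolding rP_def by (rule degree_jacobi_poly) (rule ab_nonzero jacobi_eigenvalue_inj, assumption?)+

lemma degree_qP: "degree (qP n) = n"
  unfolding qP_def by (rule degree_jacobi_poly) (rule ab_nonzero jacobi_eigenvalue_inj, assumption?)+

lemma rP_qP_nonzero: "rP n \<noteq> 0" "qP n \<noteq> 0"
proof -
  have "pochhammer (bb + 1) n \<noteq> 0" "pochhammer (bb - 1 + 1) n \<noteq> 0"
    by (rule pochhammer_nonzero, rule ab_nonzero)+
  then show "rP n \<noteq> 0" "qP n \<noteq> 0"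
    using poly_jacobi_poly_1[of aa bb n] poly_jacobi_poly_1[of aa "bb - 1" n] by (auto simp: rP_def qP_def)
qed

text \<open>The eigenvalues of the diagonal operator \<open>A B\<close> on \<open>(r\<^sub>n, q\<^sub>n)\<close>.\<close>

definition \<tau> :: "nat \<Rightarrow> 2 \<Rightarrow> complex" where
  "\<tau> n i = (if i = 1 then (kk + 1) * (aa + bb - kk) - jacobi_eigenvalue aa bb n
           else kk * (aa + bb - kk) - jacobi_eigenvalue aa (bb - 1) n)"

text \<open>They are positive, since \<open>k < \<alpha> + 1\<close> gives \<open>\<alpha> + \<beta> + 2 - k > \<beta> + 1 > 0\<close>.\<close>

lemma \<tau>_nonzero: "\<tau> n i \<noteq> 0"
proof -
  have "\<tau> n i = of_real (if i = 1 then (k + 1) * (\<alpha> + \<beta> + 2 - k) + real n * (real n + \<alpha> + \<beta> + 3)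
      else k * (\<alpha> + \<beta> + 2 - k) + real n * (real n + \<alpha> + \<beta> + 2))"
    by (simp add: \<tau>_def jacobi_eigenvalue_def aa_def bb_def kk_def algebra_simps)
  moreover have "(if i = 1 then (k + 1) * (\<alpha> + \<beta> + 2 - k) + real n * (real n + \<alpha> + \<beta> + 3)
      else k * (\<alpha> + \<beta> + 2 - k) + real n * (real n + \<alpha> + \<beta> + 2)) > 0"
    using \<alpha> \<beta> k by (auto intro!: add_pos_nonneg mult_pos_pos mult_nonneg_nonneg)
  ultimately show ?thesis by (metis of_real_eq_0_iff less_irrefl)
qed

definition Diag :: "nat \<Rightarrow> 2 mpoly" where
  "Diag n = (\<chi> i j. if i = j then (if i = 1 then rP n else qP n) else 0)"

definition \<Psi> :: "nat \<Rightarrow> 2 mpoly" where "\<Psi> n = Diag n \<lhd> dA"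

lemma \<Psi>_dB: "\<Psi> n \<lhd> dB = mpconst (\<chi> i j. if i = j then \<tau> n i else 0) ** Diag n"
  by (simp add: vec_eq_iff \<Psi>_def dB_act dA_act row_B_row_A forall_2 Diag_def jacobi_op_rP jacobi_op_qP \<tau>_def
      matrix_matrix_mult_def mpconst_def sum_2 smult_diff_left jacobi_op_def[of _ _ 0])

lemma Diag_dE: "Diag n \<lhd> dE i = mpconst (\<chi> a b. if a = i \<and> b = i then 1 else 0) ** Diag n"
  by (simp add: vec_eq_iff dE_act Diag_def matrix_matrix_mult_def mpconst_def sum_2 forall_2 one_pCons)

section \<open>The orthogonal polynomials\<close>

lemma row_degree:
  fixes p :: "complex poly ^ 2"
  assumes "\<And>i m. m \<ge> n \<Longrightarrow> coeff (p $ i) m = 0" "m \<ge> n"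
  shows "coeff (row_A p $ i) m = 0" "coeff (row_B p $ i) m = 0"
proof -
  have "coeff (p $ i) m = 0 \<and> coeff (p $ i) (Suc m) = 0" for i
    using assms by simp
  then have "\<forall>i. coeff (row_A p $ i) m = 0 \<and> coeff (row_B p $ i) m = 0"
    unfolding forall_2 by (cases m) (simp_all add: row_A_def row_B_def coeff_Y_mult coeff_Z_mult coeff_pderiv)
  then show "coeff (row_A p $ i) m = 0" "coeff (row_B p $ i) m = 0" by auto
qed

text \<open>On polynomials of degree \<open>d < n\<close> the operator is multiplication by its eigenvalue up to lower degree, where the
  functional already vanishes; but for the functional it is multiplication by the eigenvalue of degree \<open>n\<close>.\<close>

lemma jacobi_orthogonal_lower:
  fixes \<phi> :: "complex poly \<Rightarrow> complex"
  assumes diff: "\<And>u v. \<phi> (u - v) = \<phi> u - \<phi> v" and smult: "\<And>c u. \<phi> (smult c u) = c * \<phi> u"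
    and jacobi_op: "\<And>u. \<phi> (jacobi_op a b u) = jacobi_eigenvalue a b n * \<phi> u"
    and inj: "\<And>m. m < n \<Longrightarrow> jacobi_eigenvalue a b m \<noteq> jacobi_eigenvalue a b n"
    and u: "\<And>m. m \<ge> n \<Longrightarrow> coeff u m = 0"
  shows "\<phi> u = 0"
proof -
  have "d \<le> n \<Longrightarrow> (\<And>m. m \<ge> d \<Longrightarrow> coeff u m = 0) \<Longrightarrow> \<phi> u = 0" for d
  proof (induction d arbitrary: u)
    case 0
    then have "u = 0" by (simp add: poly_eq_iff)
    then show ?case using smult[of 0 0] by simp
  next
    case (Suc d)
    have "\<phi> (jacobi_op a b u - smult (jacobi_eigenvalue a b d) u) = 0"
    proof (rule Suc.IH)
      fix m assume "m \<ge> d"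
      then show "coeff (jacobi_op a b u - smult (jacobi_eigenvalue a b d) u) m = 0"
        using Suc.prems(2) by (cases "m = d") (simp_all add: coeff_jacobi_op)
    qed (use Suc.prems in simp)
    then have "(jacobi_eigenvalue a b n - jacobi_eigenvalue a b d) * \<phi> u = 0"
      by (simp add: diff smult jacobi_op algebra_simps)
    with inj[of d] Suc.prems(1) show ?case by auto
  qed
  then show ?thesis using u by blast
qed

lemma J_rP_lower:
  assumes "\<And>m. m \<ge> n \<Longrightarrow> coeff u m = 0"
  shows "J (Y * Z * rP n * u) = 0"
proof (rule jacobi_orthogonal_lower[of "\<lambda>u. J (Y * Z * rP n * u)" aa bb n])
  show "J (Y * Z * rP n * jacobi_op aa bb v) = jacobi_eigenvalue aa bb n * J (Y * Z * rP n * v)" for v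
    unfolding J_jacobi_op_selfadjoint(1)[symmetric] jacobi_op_rP by (simp add: J_smult)
qed (simp_all add: assms jacobi_eigenvalue_inj J_diff J_smult right_diff_distrib)

lemma J_qP_lower:
  assumes "\<And>m. m \<ge> n \<Longrightarrow> coeff u m = 0"
  shows "J (Y * qP n * u) = 0"
proof (rule jacobi_orthogonal_lower[of "\<lambda>u. J (Y * qP n * u)" aa "bb - 1" n])
  show "J (Y * qP n * jacobi_op aa (bb - 1) v) = jacobi_eigenvalue aa (bb - 1) n * J (Y * qP n * v)" for v
    unfolding J_jacobi_op_selfadjoint(2)[symmetric] jacobi_op_qP by (simp add: J_smult)
qed (simp_all add: assms jacobi_eigenvalue_inj J_diff J_smult right_diff_distrib)

lemma \<Psi>_orthogonal_lower:
  assumes "mdeg_less n Q"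
  shows "inner_prod (\<Psi> n) Q = 0"
proof -
  have "J (wform (\<Psi> n $ i) (conj_row (Q $ j))) = 0" for i j
  proof -
    have "coeff (conj_row (Q $ j) $ l) m = 0" if "m \<ge> n" for l m
      using assms that by (simp add: conj_row_def coeff_map_poly mdeg_less_def mpcoeff_def vec_eq_iff)
    from row_degree(2)[OF this]
    have "coeff (row_B (conj_row (Q $ j)) $ l) m = 0" if "m \<ge> n" for l m
      using that by blast
    then show ?thesis
      using J_rP_lower J_qP_lower exhaust_2[of i]
      by (auto simp: \<Psi>_def dA_act J_wform_row_A J_add J_smult Diag_def)
  qed
  then show ?thesis by (simp add: vec_eq_iff inner_entry)
qed

lemma \<Psi>_degree: "mdeg_less (Suc n) (\<Psi> n)"
proof -
  have "coeff (Diag n $ i $ l) m = 0" if "m \<ge> Suc n" for i l m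
    using that by (auto simp: Diag_def coeff_eq_0 degree_rP degree_qP)
  from row_degree(1)[OF this] have "coeff (\<Psi> n $ i $ l) m = 0" if "m \<ge> Suc n" for i l m
    using that unfolding \<Psi>_def dA_act by blast
  then show ?thesis by (simp add: mdeg_less_def mpcoeff_def vec_eq_iff)
qed

text \<open>The leading coefficient has a zero entry, and the entries on the other diagonal are nonzero multiples of
  \<open>n + \<alpha> + \<beta> + 2 - k\<close> and \<open>n + k\<close>.\<close>

lemma \<Psi>_coeff_inverse: "\<exists>L. L ** mpcoeff (\<Psi> n) n = mat 1"
proof -
  define r q where "r = coeff (rP n) n" and "q = coeff (qP n) n"
  have rq: "r \<noteq> 0" "q \<noteq> 0"
    using rP_qP_nonzero[of n] degree_rP[of n] degree_qP[of n] by (simp_all add: r_def q_def) (metis leading_coeff_0_iff)+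
  define a b d where "a = - (aa - kk) * r" and "b = (of_nat n + aa + bb - kk) * r" and "d = (kk + of_nat n) * q"
  have "of_nat n + aa + bb - kk = of_real (real n + \<alpha> + \<beta> + 2 - k)" "kk + of_nat n = of_real (k + real n)"
    by (simp_all add: aa_def bb_def kk_def)
  moreover have "real n + \<alpha> + \<beta> + 2 - k > 0" "k + real n > 0"
    using \<alpha> \<beta> k by auto
  ultimately have "of_nat n + aa + bb - kk \<noteq> 0" "kk + of_nat n \<noteq> 0"
    by (metis of_real_eq_0_iff less_irrefl)+
  with rq have bd: "b \<noteq> 0" "d \<noteq> 0" by (simp_all add: b_def d_def)
  have s: "coeff (rP n) (Suc n) = 0" "coeff (qP n) (Suc n) = 0"
    by (simp_all add: coeff_eq_0 degree_rP degree_qP)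
  have C: "mpcoeff (\<Psi> n) n = vector [vector [a, b], vector [d, 0]]"
    using s by (cases n) (simp_all add: vec_eq_iff forall_2 mpcoeff_def \<Psi>_def dA_act row_A_def Diag_def
        coeff_Y_mult coeff_Z_mult coeff_pderiv r_def q_def a_def b_def d_def algebra_simps)
  have "vector [vector [0, 1 / d], vector [1 / b, - a / (b * d)]] ** mpcoeff (\<Psi> n) n = mat 1"
    unfolding C using bd
    by (simp add: vec_eq_iff forall_2 matrix_matrix_mult_def sum_2 mat_def)
  then show ?thesis by blast
qed

lemma mpconst_mult_\<Psi>_cancel:
  assumes "mpconst M ** \<Psi> n = mpconst M' ** \<Psi> n"
  shows "M = M'"
proof -
  obtain L where L: "L ** mpcoeff (\<Psi> n) n = mat 1" using \<Psi>_coeff_inverse by blast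
  then have "mpcoeff (\<Psi> n) n ** L = mat 1" by (simp add: matrix_left_right_inverse)
  moreover have "M ** mpcoeff (\<Psi> n) n = M' ** mpcoeff (\<Psi> n) n"
    using arg_cong[OF assms, of "\<lambda>P. mpcoeff P n"] by (simp add: mpcoeff_mpconst_mult)
  ultimately show ?thesis by (metis matrix_mul_assoc matrix_mul_rid)
qed

text \<open>The monic orthogonal polynomials differ from \<open>\<Psi>\<close> by an invertible constant factor on the left, which only
  conjugates the eigenvalue matrices.\<close>

lemma alg_D_iff:
  "E \<in> alg_D I (jacobi_W \<alpha> \<beta> k) \<longleftrightarrow> (\<forall>n. \<exists>M. \<Psi> n \<lhd> E = mpconst M ** \<Psi> n)"
proof -
  obtain L where L: "\<And>n. L n ** mpcoeff (\<Psi> n) n = mat 1"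
    using \<Psi>_coeff_inverse by metis
  define P where "P n = mpconst (L n) ** \<Psi> n" for n
  have lower: "inner_prod (P n) Q = 0" if "mdeg_less n Q" for n Q
    using \<Psi>_orthogonal_lower[OF that] by (simp add: P_def inner_mpconst_mult)
  have monic: "mpcoeff (P n) n = mat 1" "m > n \<Longrightarrow> mpcoeff (P n) m = 0" for n m
    using \<Psi>_degree[of n] by (simp_all add: P_def mpcoeff_mpconst_mult L mdeg_less_def)
  have "inner_prod (P n) (P m) = 0" if "n \<noteq> m" for n m
  proof (cases "m < n")
    case True
    then show ?thesis using lower monic by (simp add: mdeg_less_def)
  next
    case False
    with that have "inner_prod (P m) (P n) = 0" using lower monic by (simp add: mdeg_less_def)
    then show ?thesis by (subst inner_eq_0_commute)
  qed
  with monic have "is_monic_ops I (jacobi_W \<alpha> \<beta> k) P"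
    by (simp add: is_monic_ops_def)
  then have P: "monic_ops I (jacobi_W \<alpha> \<beta> k) = P" by (rule monic_ops_eqI)
  have "mpcoeff (\<Psi> n) n ** L n = mat 1" for n
    using L by (simp add: matrix_left_right_inverse)
  then have \<Psi>: "\<Psi> n = mpconst (mpcoeff (\<Psi> n) n) ** P n" for n
    by (simp add: P_def matrix_mul_assoc mpconst_mult)
  have "(\<exists>M. P n \<lhd> E = mpconst M ** P n) \<longleftrightarrow> (\<exists>M. \<Psi> n \<lhd> E = mpconst M ** \<Psi> n)" for n
  proof
    assume "\<exists>M. P n \<lhd> E = mpconst M ** P n"
    then obtain M where "P n \<lhd> E = mpconst M ** P n" by blast
    then have "\<Psi> n \<lhd> E = mpconst (mpcoeff (\<Psi> n) n) ** (mpconst M ** P n)"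
      by (subst \<Psi>) (simp add: dop_act_mpconst_mult)
    then have "\<Psi> n \<lhd> E = mpconst (mpcoeff (\<Psi> n) n ** M ** L n) ** \<Psi> n"
      by (simp add: P_def matrix_mul_assoc mpconst_mult)
    then show "\<exists>M. \<Psi> n \<lhd> E = mpconst M ** \<Psi> n" by blast
  next
    assume "\<exists>M. \<Psi> n \<lhd> E = mpconst M ** \<Psi> n"
    then obtain M where "\<Psi> n \<lhd> E = mpconst M ** \<Psi> n" by blast
    then have "P n \<lhd> E = mpconst (L n) ** (mpconst M ** \<Psi> n)"
      by (simp add: P_def dop_act_mpconst_mult)
    also have "\<dots> = mpconst (L n ** M ** mpcoeff (\<Psi> n) n) ** P n"
      by (subst \<Psi>) (simp add: matrix_mul_assoc mpconst_mult)
    finally show "\<exists>M. P n \<lhd> E = mpconst M ** P n" by blast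
  qed
  then show ?thesis by (simp add: alg_D_def P)
qed

section \<open>Commutativity\<close>

text \<open>Sandwiching \<open>E\<close> between the factors reduces its off-diagonal eigenvalues to scalar operators between the
  two Jacobi families, whose second parameters differ by one.\<close>

lemma alg_D_diagonal:
  assumes "E \<in> alg_D I (jacobi_W \<alpha> \<beta> k)" "\<Psi> n \<lhd> E = mpconst M ** \<Psi> n"
  shows "M $ 1 $ 2 = 0" "M $ 2 $ 1 = 0"
proof -
  obtain N where N: "\<And>n. \<Psi> n \<lhd> E = mpconst (N n) ** \<Psi> n"
    using assms(1) unfolding alg_D_iff by metis
  define G where "G = dA \<odot> E \<odot> dB"
  let ?g = "\<lambda>i j l. Poly_Mapping.lookup G j $ i $ l"
  have "Diag n \<lhd> G = mpconst (N n) ** (mpconst (\<chi> i j. if i = j then \<tau> n i else 0) ** Diag n)" for n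
    by (simp add: G_def dop_act_mult dop_act_mpconst_mult N flip: \<Psi>_def \<Psi>_dB)
  then have G: "(Diag n \<lhd> G) $ 1 $ 2 = smult (N n $ 1 $ 2 * \<tau> n 2) (qP n)"
    "(Diag n \<lhd> G) $ 2 $ 1 = smult (N n $ 2 $ 1 * \<tau> n 1) (rP n)" for n
    by (simp_all add: matrix_matrix_mult_def sum_2 mpconst_def Diag_def)
  have "(\<Sum>j\<in>Poly_Mapping.keys G. (pderiv ^^ j) (rP n) * ?g 1 j 2) = smult (N n $ 1 $ 2 * \<tau> n 2) (qP n)" for n
    unfolding G[symmetric] dop_act_entry by (simp add: sum_2 Diag_def)
  then have "N n $ 1 $ 2 * \<tau> n 2 = 0"
    unfolding rP_def qP_def by (rule no_intertwiner[rotated 4]) (use ab_nonzero in auto)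
  moreover have "(\<Sum>j\<in>Poly_Mapping.keys G. (pderiv ^^ j) (qP n) * ?g 2 j 1) = smult (N n $ 2 $ 1 * \<tau> n 1) (rP n)" for n
    unfolding G[symmetric] dop_act_entry by (simp add: sum_2 Diag_def)
  then have "N n $ 2 $ 1 * \<tau> n 1 = 0"
    unfolding rP_def qP_def by (rule no_intertwiner[rotated 4]) (use ab_nonzero in auto)
  moreover have "M = N n"
    using assms(2) N mpconst_mult_\<Psi>_cancel by metis
  ultimately show "M $ 1 $ 2 = 0" "M $ 2 $ 1 = 0"
    using \<tau>_nonzero by simp_all
qed

lemma commutative: "commutative_D I (jacobi_W \<alpha> \<beta> k)"
  unfolding commutative_D_def
proof (intro ballI dop_eqI_basis[of \<Psi>, OF \<Psi>_degree \<Psi>_coeff_inverse])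
  fix D E n assume D: "D \<in> alg_D I (jacobi_W \<alpha> \<beta> k)" and E: "E \<in> alg_D I (jacobi_W \<alpha> \<beta> k)"
  then obtain M N where M: "\<Psi> n \<lhd> D = mpconst M ** \<Psi> n" and N: "\<Psi> n \<lhd> E = mpconst N ** \<Psi> n"
    unfolding alg_D_iff by metis
  have "M ** N = N ** M"
    using alg_D_diagonal[OF D M] alg_D_diagonal[OF E N]
    by (simp add: vec_eq_iff forall_2 matrix_matrix_mult_def sum_2)
  then show "\<Psi> n \<lhd> (D \<odot> E) = \<Psi> n \<lhd> (E \<odot> D)"
    by (simp add: dop_act_mult M N dop_act_mpconst_mult matrix_mul_assoc mpconst_mult)
qed

section \<open>The orthogonal symmetric operators\<close>

definition \<DD> :: "2 \<Rightarrow> 2 diffop" where "\<DD> i = dB \<odot> dE i \<odot> dA"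

lemma \<Psi>_\<DD>: "\<Psi> n \<lhd> \<DD> i = mpconst (\<chi> a b. if a = i \<and> b = i then \<tau> n i else 0) ** \<Psi> n"
proof -
  have "(\<chi> i j. if i = j then \<tau> n i else 0) ** (\<chi> a b. if a = i \<and> b = i then 1 else 0)
      = (\<chi> a b. if a = i \<and> b = i then \<tau> n i else 0)"
    using exhaust_2[of i] by (auto simp: vec_eq_iff matrix_matrix_mult_def sum_2 forall_2)
  then show ?thesis
    by (simp add: \<DD>_def dop_act_mult \<Psi>_dB dop_act_mpconst_mult Diag_dE matrix_mul_assoc mpconst_mult)
      (simp add: dop_act_mpconst_mult \<Psi>_def)
qed

text \<open>Moving \<open>A\<close> across the form produces \<open>B\<close>, so both sides become the same symmetric expression in \<open>B P\<close> and
  \<open>B Q\<close>.\<close>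

lemma \<DD>_symmetric: "W_symmetric I (jacobi_W \<alpha> \<beta> k) (\<DD> i)"
  unfolding W_symmetric_def
proof (intro allI)
  fix P Q :: "2 mpoly"
  define e where "e p = (\<chi> b. if b = i then p $ i else 0)" for p :: "complex poly ^ 2"
  have act: "(P \<lhd> \<DD> i) $ a = row_A (e (row_B (P $ a)))" for P a
  proof -
    have "(P \<lhd> dB \<lhd> dE i) $ a = e (row_B (P $ a))"
      by (simp add: vec_eq_iff e_def dE_act dB_act)
    then show ?thesis by (simp add: \<DD>_def dop_act_mult dA_act)
  qed
  have cA: "conj_row (row_A p) = row_A (conj_row p)" and cB: "conj_row (row_B p) = row_B (conj_row p)"
    and ce: "conj_row (e p) = e (conj_row p)" for p
    by (simp_all add: vec_eq_iff forall_2 conj_row_def row_A_def row_B_def e_def map_poly_cnj_arith)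
  have sym: "J (wform (row_A (e (row_B p))) q) = J (wform p (row_A (e (row_B q))))" for p q
    unfolding wform_commute[of p] J_wform_row_A by (simp add: e_def mult_ac)
  show "inner_prod (P \<lhd> \<DD> i) Q = inner_prod P (Q \<lhd> \<DD> i)"
    by (simp add: vec_eq_iff inner_entry act cA cB ce sym)
qed

lemma \<DD>_in_alg_D: "\<DD> i \<in> alg_D I (jacobi_W \<alpha> \<beta> k)"
  unfolding alg_D_iff using \<Psi>_\<DD> by blast

lemma full: "full_D I (jacobi_W \<alpha> \<beta> k)"
  unfolding full_D_def
proof (intro exI[of _ \<DD>] conjI allI impI)
  let ?S = "\<Sum>i\<in>UNIV. \<DD> i"
  let ?T = "\<lambda>n. \<chi> a b. if a = b then \<tau> n a else 0"
  have S: "\<Psi> n \<lhd> ?S = mpconst (?T n) ** \<Psi> n" for n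
    by (simp add: sum_2 dop_act_add \<Psi>_\<DD> flip: matrix_add_rdistrib')
      (simp add: vec_eq_iff forall_2 matrix_matrix_mult_def sum_2 mpconst_def)
  then have "?S \<in> alg_D I (jacobi_W \<alpha> \<beta> k)" unfolding alg_D_iff by blast
  then show "?S \<in> center_D I (jacobi_W \<alpha> \<beta> k)"
    using commutative by (simp add: center_D_def commutative_D_def)
  show "\<not> zero_divisor_D I (jacobi_W \<alpha> \<beta> k) ?S"
    unfolding zero_divisor_D_def
  proof (intro notI, elim bexE conjE)
    fix E assume E: "E \<in> alg_D I (jacobi_W \<alpha> \<beta> k)" "E \<noteq> 0" and 0: "?S \<odot> E = 0 \<or> E \<odot> ?S = 0"
    have "?S \<odot> E = 0"
      using 0 E(1) \<open>?S \<in> alg_D _ _\<close> commutative unfolding commutative_D_def by metis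
    have "\<Psi> n \<lhd> E = \<Psi> n \<lhd> 0" for n
    proof -
      obtain M where M: "\<Psi> n \<lhd> E = mpconst M ** \<Psi> n" using E(1) unfolding alg_D_iff by blast
      have "mpconst (?T n ** M) ** \<Psi> n = \<Psi> n \<lhd> (?S \<odot> E)"
        by (simp only: dop_act_mult S dop_act_mpconst_mult M matrix_mul_assoc mpconst_mult)
      also have "\<dots> = mpconst 0 ** \<Psi> n"
        unfolding \<open>?S \<odot> E = 0\<close> by (simp add: vec_eq_iff matrix_matrix_mult_def)
      finally have "?T n ** M = 0" by (rule mpconst_mult_\<Psi>_cancel)
      then have "M = 0"
        using \<tau>_nonzero by (simp add: vec_eq_iff forall_2 matrix_matrix_mult_def sum_2)
      then have "mpconst M ** \<Psi> n = 0" by (simp add: vec_eq_iff matrix_matrix_mult_def mpconst_def)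
      then show ?thesis using M by simp
    qed
    then have "E = 0" by (rule dop_eqI_basis[of \<Psi>, OF \<Psi>_degree \<Psi>_coeff_inverse])
    with E(2) show False ..
  qed
  show "\<DD> i \<in> alg_D I (jacobi_W \<alpha> \<beta> k)" for i by (rule \<DD>_in_alg_D)
  show "W_symmetric I (jacobi_W \<alpha> \<beta> k) (\<DD> i)" for i by (rule \<DD>_symmetric)
  show "\<DD> i \<noteq> 0" for i
  proof
    assume "\<DD> i = 0"
    then have "mpconst (\<chi> a b. if a = i \<and> b = i then \<tau> 0 i else 0) ** \<Psi> 0 = mpconst 0 ** \<Psi> 0"
      unfolding \<Psi>_\<DD>[symmetric] by (simp add: vec_eq_iff matrix_matrix_mult_def)
    then have "(\<chi> a b. if a = i \<and> b = i then \<tau> 0 i else 0) = 0"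
      by (rule mpconst_mult_\<Psi>_cancel)
    then have "(\<chi> a b. if a = i \<and> b = i then \<tau> 0 i else 0) $ i $ i = 0" by simp
    then have "\<tau> 0 i = 0" by simp
    then show False using \<tau>_nonzero by blast
  qed
  show "\<DD> i \<odot> \<DD> j = 0" if "i \<noteq> j" for i j
  proof (rule dop_eqI_basis[of \<Psi>, OF \<Psi>_degree \<Psi>_coeff_inverse])
    fix n
    have "(\<chi> a b. if a = i \<and> b = i then \<tau> n i else 0) ** (\<chi> a b. if a = j \<and> b = j then \<tau> n j else 0) = 0"
      using that by (auto simp: vec_eq_iff matrix_matrix_mult_def intro!: sum.neutral)
    then show "\<Psi> n \<lhd> (\<DD> i \<odot> \<DD> j) = \<Psi> n \<lhd> 0"
      by (simp add: dop_act_mult \<Psi>_\<DD> dop_act_mpconst_mult matrix_mul_assoc mpconst_mult)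
  qed
qed

end

theorem proposition7p4:
  fixes \<alpha> \<beta> k :: real
  assumes "\<alpha> > -1" and "\<beta> > -1" and "0 < k" and "k < \<alpha> + 1"
  shows "commutative_D {-1<..<1} (jacobi_W \<alpha> \<beta> k) \<and> full_D {-1<..<1} (jacobi_W \<alpha> \<beta> k)"
proof -
  interpret jacobi_weight \<alpha> \<beta> k
    using assms by unfold_locales
  show ?thesis using commutative full by blast
qed

end
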